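(* Let $\mathbb{K}=\mathbb{R}$ or $\mathbb{C}$. Let $\mathcal{G}$ and $\mathcal{H}$ be locally compact Hausdorff étale groupoids with continuous fully supported left Haar systems $\lambda_{\mathcal{G}}$ and $\lambda_{\mathcal{H}}$, respectively, and let $T\colon C_c(\mathcal{G})\to C_c(\mathcal{H})$ be a diagonal-preserving isomorphism of ($\mathbb{K}$-)algebras (with convolution products), isometric with respect to the $(I,\mathfrak{r})$-norms. Then there are a (unique) topological groupoid isomorphism $\phi\colon\mathcal{H}\to\mathcal{G}$ and a continuous groupoid morphism $p\colon\mathcal{H}\to\mathbb{S}^1$ such that $$Tf(h)=p(h)\,D(\phi(h))\,f(\phi(h))\qquad\text{for all } f\in C_c(\mathcal{G}),\ h\in\mathcal{H},$$ where $D$ is a continuous instance of the Radon--Nikodym derivative $$D(a)=\frac{d\lambda_{\mathcal{G}}^{\mathfrak{r}(a)}}{d\big(\phi_*\lambda_{\mathcal{H}}^{\phi^{-1}(\mathfrak{r}(a))}\big)}(a),\qquad a\in\mathcal{G}.$$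
   Context: A groupoid $\mathcal{G}$ is a small category with inverses; a topological groupoid carries a topology making product and inversion continuous. Put $\mathfrak{s}(a)=a^{-1}a$, $\mathfrak{r}(a)=aa^{-1}$, $\mathcal{G}^{(0)}=\mathfrak{s}(\mathcal{G})$ (unit space), $\mathcal{G}^x=\mathfrak{r}^{-1}(x)$ for $x\in\mathcal{G}^{(0)}$. A locally compact Hausdorff groupoid is étale if $\mathfrak{r}\colon\mathcal{G}\to\mathcal{G}^{(0)}$ is a local homeomorphism; then $\mathcal{G}^{(0)}$ is open and closed in $\mathcal{G}$. A topological groupoid isomorphism is a groupoid isomorphism which is a homeomorphism. $\mathbb{S}^1$ is the circle group. $C_c(\mathcal{G})$ is the space of continuous compactly supported functions $\mathcal{G}\to\mathbb{K}$. A Borel measure $\mu$ on a locally compact Hausdorff space is regular if compact sets have finite measure, $\mu(E)=\inf\{\mu(V):E\subseteq V\text{ open}\}$ for every Borel $E$, and $\mu(U)=\sup\{\mu(K):K\subseteq U\text{ compact}\}$ for every open $U$. Its support is the set of points all of whose neighbourhoods have positive measure. A continuous left Haar system on $\mathcal{G}$ is a family $\lambda=\{\lambda^x:x\in\mathcal{G}^{(0)}\}$ of regular Borel measures on $\mathcal{G}$ such that: (i) the support of $\lambda^x$ is contained in $\mathcal{G}^x$; (ii) $\lambda^{\mathfrak{r}(a)}(aE)=\lambda^{\mathfrak{s}(a)}(E)$ for every $a\in\mathcal{G}$ and every compact $E\subseteq\mathcal{G}^{\mathfrak{s}(a)}$; (iii) for each $f\in C_c(\mathcal{G})$ the map $x\mapsto\int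 f\,d\lambda^x$ is continuous on $\mathcal{G}^{(0)}$. It is fully supported if the support of $\lambda^x$ is $\mathcal{G}^x$ for every $x$. The convolution product on $C_c(\mathcal{G})$ is $(fg)(a)=\int f(s)g(s^{-1}a)\,d\lambda^{\mathfrak{r}(a)}(s)$, and the $(I,\mathfrak{r})$-norm is $\|f\|_{I,\mathfrak{r}}=\sup_{x\in\mathcal{G}^{(0)}}\int|f|\,d\lambda^x$. $C_c(\mathcal{G}^{(0)})$ is identified with the subalgebra $\{f\in C_c(\mathcal{G}):\operatorname{supp}(f)\subseteq\mathcal{G}^{(0)}\}$ of $C_c(\mathcal{G})$ (the diagonal subalgebra). $T$ is diagonal-preserving if $T(C_c(\mathcal{G}^{(0)}))=C_c(\mathcal{H}^{(0)})$. $\phi_*$ denotes push-forward of measures. That $D$ is a continuous instance of the displayed Radon--Nikodym derivative means: $D\colon\mathcal{G}\to[0,\infty)$ is continuous and for every $x\in\mathcal{G}^{(0)}$ the restriction $D|_{\mathcal{G}^x}$ is a density of $\lambda_{\mathcal{G}}^x$ with respect to $\phi_*\lambda_{\mathcal{H}}^{\phi^{-1}(x)}$, i.e. $\lambda_{\mathcal{G}}^x(E)=\int_E D\,d(\phi_*\lambda_{\mathcal{H}}^{\phi^{-1}(x)})$ for every Borel $E\subseteq\mathcal{G}^x$. *)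

theory Defs
  imports "HOL-Analysis.Analysis"
begin

section \<open>Groupoids\<close>

text \<open>
  A groupoid is presented by its arrows alone: the elements of the type are the arrows, and
  the objects are identified with the identity arrows. The operation \<open>gmult\<close> is total only
  because HOL functions are; its values are meaningful only on composable pairs, and every
  notion below refers to it only there.
\<close>

record 'a groupoid_ops =
  gmult :: "'a \<Rightarrow> 'a \<Rightarrow> 'a"
  ginv :: "'a \<Rightarrow> 'a"

definition src :: "'a groupoid_ops \<Rightarrow> 'a \<Rightarrow> 'a" where
  "src G a = gmult G (ginv G a) a"

definition rng :: "'a groupoid_ops \<Rightarrow> 'a \<Rightarrow> 'a" where
  "rng G a = gmult G a (ginv G a)"

definition composable :: "'a groupoid_ops \<Rightarrow> 'a \<Rightarrow> 'a \<Rightarrow> bool" where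
  "composable G a b \<longleftrightarrow> src G a = rng G b"

definition units :: "'a groupoid_ops \<Rightarrow> 'a set" where
  "units G = range (src G)"

definition rfibre :: "'a groupoid_ops \<Rightarrow> 'a \<Rightarrow> 'a set" where
  "rfibre G x = {a. rng G a = x}"

text \<open>
  Category with inverses: \<open>src a\<close> and \<open>rng a\<close> are the domain and codomain of \<open>a\<close>. That
  \<open>ginv a\<close> is a two-sided inverse of \<open>a\<close> is the definition of \<open>src\<close> and \<open>rng\<close>, together
  with the axioms saying that \<open>ginv a\<close> runs backwards and that units are identities.
\<close>

locale groupoid =
  fixes G :: "'a groupoid_ops"
  assumes src_ginv: "src G (ginv G a) = rng G a"
    and rng_ginv: "rng G (ginv G a) = src G a"
    and src_gmult: "composable G a b \<Longrightarrow> src G (gmult G a b) = src G b"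
    and rng_gmult: "composable G a b \<Longrightarrow> rng G (gmult G a b) = rng G a"
    and gmult_assoc: "composable G a b \<Longrightarrow> composable G b c \<Longrightarrow>
          gmult G (gmult G a b) c = gmult G a (gmult G b c)"
    and gmult_src: "gmult G a (src G a) = a"
    and gmult_rng: "gmult G (rng G a) a = a"

locale topological_groupoid = groupoid G
  for G :: "'a::topological_space groupoid_ops" +
  assumes continuous_gmult:
      "continuous_on {(a, b). composable G a b} (\<lambda>(a, b). gmult G a b)"
    and continuous_ginv: "continuous_on UNIV (ginv G)"

definition local_homeomorphism_onto ::
    "('a::topological_space \<Rightarrow> 'b::topological_space) \<Rightarrow> 'b set \<Rightarrow> bool" where
  "local_homeomorphism_onto f Y \<longleftrightarrow>
     range f \<subseteq> Y \<and>
     (\<forall>a. \<exists>U. open U \<and> a \<in> U \<and> openin (top_of_set Y) (f ` U) \<and>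
            (\<exists>g. homeomorphism U (f ` U) f g))"

locale lch_etale_groupoid = topological_groupoid G
  for G :: "'a::t2_space groupoid_ops" +
  assumes locally_compact: "locally_compact_space (euclidean :: 'a topology)"
    and etale: "local_homeomorphism_onto (rng G) (units G)"

definition groupoid_morphism ::
    "'a groupoid_ops \<Rightarrow> 'b groupoid_ops \<Rightarrow> ('a \<Rightarrow> 'b) \<Rightarrow> bool" where
  "groupoid_morphism H G \<phi> \<longleftrightarrow>
     (\<forall>a b. composable H a b \<longrightarrow>
        composable G (\<phi> a) (\<phi> b) \<and> \<phi> (gmult H a b) = gmult G (\<phi> a) (\<phi> b))"

definition topological_groupoid_isomorphism ::
    "'a::topological_space groupoid_ops \<Rightarrow> 'b::topological_space groupoid_ops
      \<Rightarrow> ('a \<Rightarrow> 'b) \<Rightarrow> bool" where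
  "topological_groupoid_isomorphism H G \<phi> \<longleftrightarrow>
     groupoid_morphism H G \<phi> \<and> bij \<phi> \<and> groupoid_morphism G H (inv \<phi>) \<and>
     homeomorphic_map euclidean euclidean \<phi>"

definition continuous_circle_morphism ::
    "'a::topological_space groupoid_ops \<Rightarrow> ('a \<Rightarrow> complex) \<Rightarrow> bool" where
  "continuous_circle_morphism H p \<longleftrightarrow>
     continuous_on UNIV p \<and> (\<forall>h. norm (p h) = 1) \<and>
     (\<forall>a b. composable H a b \<longrightarrow> p (gmult H a b) = p a * p b)"


section \<open>Compactly supported functions\<close>

text \<open>
  The scalar field \<open>K\<close> is a subset of the complex numbers, namely \<open>\<real>\<close> or \<open>UNIV\<close>, so that
  both cases are covered by one definition.
\<close>

definition supp :: "('a::topological_space \<Rightarrow> complex) \<Rightarrow> 'a set" where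
  "supp f = closure {a. f a \<noteq> 0}"

definition Cc :: "complex set \<Rightarrow> ('a::topological_space \<Rightarrow> complex) set" where
  "Cc K = {f. continuous_on UNIV f \<and> compact (supp f) \<and> range f \<subseteq> K}"

definition Cc_diag ::
    "complex set \<Rightarrow> 'a::topological_space groupoid_ops \<Rightarrow> ('a \<Rightarrow> complex) set" where
  "Cc_diag K G = {f \<in> Cc K. supp f \<subseteq> units G}"


section \<open>Haar systems\<close>

definition regular_borel_measure :: "'a::topological_space measure \<Rightarrow> bool" where
  "regular_borel_measure M \<longleftrightarrow>
     sets M = sets borel \<and>
     (\<forall>C. compact C \<longrightarrow> emeasure M C < \<infinity>) \<and>
     (\<forall>E \<in> sets borel. emeasure M E = (INF V \<in> {V. open V \<and> E \<subseteq> V}. emeasure M V)) \<and>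
     (\<forall>U. open U \<longrightarrow> emeasure M U = (SUP C \<in> {C. compact C \<and> C \<subseteq> U}. emeasure M C))"

definition measure_supp :: "'a::topological_space measure \<Rightarrow> 'a set" where
  "measure_supp M = {a. \<forall>U. open U \<and> a \<in> U \<longrightarrow> emeasure M U > 0}"

text \<open>Only the measures \<open>\<mu> x\<close> with \<open>x \<in> units G\<close> are part of the system.\<close>

locale haar_system =
  fixes K :: "complex set"
    and G :: "'a::t2_space groupoid_ops"
    and \<mu> :: "'a \<Rightarrow> 'a measure"
  assumes regular: "x \<in> units G \<Longrightarrow> regular_borel_measure (\<mu> x)"
    and supp_subset: "x \<in> units G \<Longrightarrow> measure_supp (\<mu> x) \<subseteq> rfibre G x"
    and left_invariant: "compact E \<Longrightarrow> E \<subseteq> rfibre G (src G a) \<Longrightarrow>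
          emeasure (\<mu> (rng G a)) (gmult G a ` E) = emeasure (\<mu> (src G a)) E"
    and continuous_integral: "f \<in> Cc K \<Longrightarrow>
          continuous_on (units G) (\<lambda>x. integral\<^sup>L (\<mu> x) f)"

locale fully_supported_haar_system = haar_system +
  assumes fully_supported: "x \<in> units G \<Longrightarrow> measure_supp (\<mu> x) = rfibre G x"

text \<open>
  The integral runs over the fibre, which carries the measure: off the fibre
  \<open>gmult G (ginv G s) a\<close> is a value of \<open>gmult\<close> at a non-composable pair, and the integrand
  need not even be measurable there.
\<close>

definition convolution ::
    "'a groupoid_ops \<Rightarrow> ('a \<Rightarrow> 'a measure) \<Rightarrow>
      ('a \<Rightarrow> complex) \<Rightarrow> ('a \<Rightarrow> complex) \<Rightarrow> 'a \<Rightarrow> complex" where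
  "convolution G \<mu> f g a =
     set_lebesgue_integral (\<mu> (rng G a)) (rfibre G (rng G a))
       (\<lambda>s. f s * g (gmult G (ginv G s) a))"

definition Ir_norm ::
    "'a groupoid_ops \<Rightarrow> ('a \<Rightarrow> 'a measure) \<Rightarrow> ('a \<Rightarrow> complex) \<Rightarrow> real" where
  "Ir_norm G \<mu> f = (SUP x \<in> units G. integral\<^sup>L (\<mu> x) (\<lambda>a. norm (f a)))"

definition convolution_algebra_isomorphism ::
    "complex set \<Rightarrow>
      'a::topological_space groupoid_ops \<Rightarrow> ('a \<Rightarrow> 'a measure) \<Rightarrow>
      'b::topological_space groupoid_ops \<Rightarrow> ('b \<Rightarrow> 'b measure) \<Rightarrow>
      (('a \<Rightarrow> complex) \<Rightarrow> 'b \<Rightarrow> complex) \<Rightarrow> bool" where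
  "convolution_algebra_isomorphism K G \<mu>G H \<mu>H T \<longleftrightarrow>
     bij_betw T (Cc K) (Cc K) \<and>
     (\<forall>f \<in> Cc K. \<forall>g \<in> Cc K. T (\<lambda>a. f a + g a) = (\<lambda>h. T f h + T g h)) \<and>
     (\<forall>c \<in> K. \<forall>f \<in> Cc K. T (\<lambda>a. c * f a) = (\<lambda>h. c * T f h)) \<and>
     (\<forall>f \<in> Cc K. \<forall>g \<in> Cc K. T (convolution G \<mu>G f g) = convolution H \<mu>H (T f) (T g))"

definition continuous_RN_derivative ::
    "'a::topological_space groupoid_ops \<Rightarrow> ('a \<Rightarrow> 'a measure) \<Rightarrow>
      ('b \<Rightarrow> 'b measure) \<Rightarrow> ('b \<Rightarrow> 'a) \<Rightarrow> ('a \<Rightarrow> real) \<Rightarrow> bool" where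
  "continuous_RN_derivative G \<mu>G \<mu>H \<phi> D \<longleftrightarrow>
     continuous_on UNIV D \<and> (\<forall>a. 0 \<le> D a) \<and>
     (\<forall>x \<in> units G. \<forall>E \<in> sets borel. E \<subseteq> rfibre G x \<longrightarrow>
        emeasure (\<mu>G x) E =
          (\<integral>\<^sup>+ a \<in> E. ennreal (D a) \<partial>(distr (\<mu>H (inv \<phi> x)) borel \<phi>)))"

end

theory Submission
  imports Defs
begin

text \<open>
  An etale groupoid has discrete fibres, so each measure of a fully supported Haar system is a
  sum of point masses, and by left invariance the mass of an arrow depends only on its source;
  convolutions become finite sums. On the diagonal subalgebras \<open>T\<close> is, up to these masses,
  composition with a bijection of the unit spaces. Multiplying by diagonal bump functions
  localises the \<open>(I, r)\<close>-norm, so \<open>T\<close> induces a linear isometry between the weighted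
  \<open>l\<^sup>1\<close> spaces of corresponding fibres. Such an isometry preserves disjointness of supports,
  because \<open>\<bar>u + v\<bar> = \<bar>u - v\<bar> = \<bar>u\<bar> + \<bar>v\<bar>\<close> forces \<open>u = 0\<close> or \<open>v = 0\<close>; hence it is a
  weighted permutation of the arrows. Testing multiplicativity on functions supported in small
  bisections shows that the permutation is a groupoid morphism and that the weights, divided by
  the ratio of the masses, form a cocycle with values in the circle.
\<close>

section \<open>Etale groupoids\<close>

text \<open>No countability is assumed, and fibres may be uncountable. This is felt twice:
  regularity, not a countable cover, has to show that a Haar measure has no mass off its fibre, and
  the density formula must also be proved for uncountable Borel sets. On the diagonal, replacing
  \<open>d\<close> by its product with the mass turns convolution into the pointwise product;
  evaluating \<open>T d\<close> at a unit then becomes a character of a function algebra, which is a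
  point evaluation. The norm can be localised because continuity of Haar integrals makes the norm on
  a fibre a continuous function of the unit: a bump concentrated near a unit makes the global norm
  almost equal to the norm on that one fibre. The estimate obtained is one-sided, and its
  application to the inverse of \<open>T\<close> supplies the other side. Products of two general
  functions are compared only at the end, and only when one factor lives on a bisection, where the
  product is a continuous one-term formula.\<close>

context groupoid
begin

lemma src_rng [simp]: "src G (rng G a) = rng G a"
  using src_gmult[of a "ginv G a"] by (simp add: composable_def rng_ginv src_ginv rng_def[symmetric])

lemma rng_rng [simp]: "rng G (rng G a) = rng G a"
  using rng_gmult[of a "ginv G a"] by (simp add: composable_def rng_ginv rng_def[symmetric])

lemma rng_src [simp]: "rng G (src G a) = src G a"
  using rng_gmult[of "ginv G a" a] by (simp add: composable_def src_ginv rng_ginv src_def[symmetric])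

lemma src_in_units [simp]: "src G a \<in> units G"
  by (simp add: units_def)

lemma rng_in_units [simp]: "rng G a \<in> units G"
  using src_rng[of a] by (metis src_in_units)

lemma units_iff_rng: "x \<in> units G \<longleftrightarrow> rng G x = x"
  by (metis imageE rng_in_units rng_src units_def)

lemma rng_unit: "x \<in> units G \<Longrightarrow> rng G x = x"
  by (simp add: units_iff_rng)

lemma src_unit: "x \<in> units G \<Longrightarrow> src G x = x"
  by (metis rng_unit src_rng)

lemma ginv_unit: "x \<in> units G \<Longrightarrow> ginv G x = x"
  by (metis gmult_rng rng_def rng_ginv src_unit units_iff_rng)

lemma ginv_gmult_cancel:
  assumes "src G a = rng G b"
  shows "gmult G (ginv G a) (gmult G a b) = b"
proof -
  have "gmult G (gmult G (ginv G a) a) b = gmult G (ginv G a) (gmult G a b)"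
    using assms by (intro gmult_assoc) (simp_all add: composable_def src_ginv)
  thus ?thesis using assms by (metis gmult_rng src_def)
qed

lemma ginv_ginv [simp]: "ginv G (ginv G a) = a"
proof -
  have "gmult G (ginv G (ginv G a)) (gmult G (ginv G a) a) = a"
    by (rule ginv_gmult_cancel) (simp add: src_ginv)
  thus ?thesis by (metis gmult_src rng_ginv src_def src_ginv)
qed

lemma gmult_ginv_cancel:
  assumes "rng G a = rng G c"
  shows "gmult G a (gmult G (ginv G a) c) = c"
  using ginv_gmult_cancel[of "ginv G a" c] assms by (simp add: src_ginv)

lemma rng_ginv_gmult:
  "rng G a = rng G c \<Longrightarrow> rng G (gmult G (ginv G a) c) = src G a"
  by (simp add: composable_def rng_gmult rng_ginv src_ginv)

text \<open>The reason why a diagonal second factor leaves one term of a convolution: it is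
  evaluated at \<open>gmult G (ginv G s) a\<close>, a unit only for \<open>s = a\<close>.\<close>

lemma ginv_gmult_unit_iff:
  assumes "rng G a = rng G c"
  shows "gmult G (ginv G a) c \<in> units G \<longleftrightarrow> a = c"
proof
  assume *: "gmult G (ginv G a) c \<in> units G"
  hence "gmult G (ginv G a) c = src G a"
    using rng_ginv_gmult[OF assms] rng_unit by metis
  thus "a = c" using gmult_ginv_cancel[OF assms] gmult_src by metis
qed (simp add: src_def[symmetric])

lemma rfibre_iff: "a \<in> rfibre G x \<longleftrightarrow> rng G a = x"
  by (simp add: rfibre_def)

lemma gmult_eq_iff:
  assumes "src G a = rng G b" "rng G a = rng G c"
  shows "gmult G (ginv G a) c = b \<longleftrightarrow> c = gmult G a b"
  using assms ginv_gmult_cancel gmult_ginv_cancel by metis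

end

section \<open>Continuous functions with compact support\<close>

lemma Cc_I:
  "continuous_on UNIV f \<Longrightarrow> compact (supp f) \<Longrightarrow> range f \<subseteq> K \<Longrightarrow> f \<in> Cc K"
  by (simp add: Cc_def)

lemma Cc_continuous: "f \<in> Cc K \<Longrightarrow> continuous_on UNIV f"
  by (simp add: Cc_def)

lemma Cc_compact_supp: "f \<in> Cc K \<Longrightarrow> compact (supp f)"
  by (simp add: Cc_def)

lemma Cc_in: "f \<in> Cc K \<Longrightarrow> f x \<in> K"
  by (auto simp: Cc_def)

lemma nonzero_in_supp: "f x \<noteq> 0 \<Longrightarrow> x \<in> supp f"
  unfolding supp_def by (rule subsetD[OF closure_subset]) simp

lemma zero_off_supp: "x \<notin> supp f \<Longrightarrow> f x = 0"
  using nonzero_in_supp by blast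

lemma supp_mono: "(\<And>x. g x \<noteq> 0 \<Longrightarrow> f x \<noteq> 0) \<Longrightarrow> supp g \<subseteq> supp f"
  unfolding supp_def by (intro closure_mono) auto

lemma supp_subset_closed: "closed C \<Longrightarrow> (\<And>x. g x \<noteq> 0 \<Longrightarrow> x \<in> C) \<Longrightarrow> supp g \<subseteq> C"
  unfolding supp_def by (intro closure_minimal) auto

lemma compact_supp_subset: "compact C \<Longrightarrow> supp g \<subseteq> C \<Longrightarrow> compact (supp g)"
  using compact_Int_closed[of C "supp g"] by (simp add: supp_def inf_absorb2)

lemma Cc_dominated:
  assumes "f \<in> Cc K" "continuous_on UNIV g" "\<And>x. g x \<in> K" "\<And>x. g x \<noteq> 0 \<Longrightarrow> f x \<noteq> 0"
  shows "g \<in> Cc K"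
proof (rule Cc_I)
  have "supp g \<subseteq> supp f" by (rule supp_mono) (rule assms(4))
  thus "compact (supp g)" by (rule compact_supp_subset[OF Cc_compact_supp[OF assms(1)]])
qed (use assms in auto)

text \<open>A quotient and a convolution below are given by formulas continuous only on an open set;
  vanishing off a closed subset of it makes them continuous everywhere.\<close>

lemma continuous_on_extend_zero:
  fixes f :: "'a::topological_space \<Rightarrow> 'b::real_normed_vector"
  assumes "open U" "continuous_on U f" "supp' \<subseteq> U" "closed supp'" "\<And>x. x \<notin> supp' \<Longrightarrow> f x = 0"
  shows "continuous_on UNIV f"
proof -
  have "continuous_on (- supp') f"
    by (rule continuous_on_eq[of _ "\<lambda>_. 0"]) (use assms in auto)
  hence "continuous_on (U \<union> - supp') f"
    using assms by (intro continuous_on_open_Un) auto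
  moreover have "U \<union> - supp' = UNIV" using assms by auto
  ultimately show ?thesis by simp
qed

lemma continuous_on_nonzero_open:
  fixes f :: "'a::topological_space \<Rightarrow> 'b::t1_space"
  assumes "continuous_on UNIV f"
  shows "open {x. f x \<noteq> c}"
proof -
  have "open (f -` (- {c}))" by (rule open_vimage[OF _ assms]) auto
  thus ?thesis by (simp add: vimage_def)
qed

section \<open>Open unit space, discrete fibres, bump functions\<close>

context lch_etale_groupoid
begin

lemma continuous_rng: "continuous_on S (rng G)"
proof -
  have "continuous_on UNIV (\<lambda>a. (\<lambda>(a, b). gmult G a b) (a, ginv G a))"
    by (rule continuous_on_compose2[OF continuous_gmult])
      (auto intro!: continuous_intros continuous_ginv simp: composable_def rng_ginv)
  hence "continuous_on UNIV (rng G)" by (simp add: rng_def[abs_def])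
  thus ?thesis by (rule continuous_on_subset) simp
qed

lemma continuous_src: "continuous_on S (src G)"
proof -
  have "continuous_on UNIV (\<lambda>a. rng G (ginv G a))"
    by (rule continuous_on_compose2[OF continuous_rng continuous_ginv]) auto
  hence "continuous_on UNIV (src G)" by (simp add: rng_ginv)
  thus ?thesis by (rule continuous_on_subset) simp
qed

text \<open>Let \<open>rng G\<close> be injective on a neighbourhood of a unit. If \<open>a\<close>
  and \<open>rng G a\<close> both lie in it, they have the same range, hence coincide.\<close>

lemma open_units: "open (units G)"
proof (subst open_subopen, rule ballI)
  fix x assume x: "x \<in> units G"
  obtain U where U: "open U" "x \<in> U" "\<exists>g. homeomorphism U (rng G ` U) (rng G) g"
    using etale unfolding local_homeomorphism_onto_def by metis
  then obtain g where "\<And>a. a \<in> U \<Longrightarrow> g (rng G a) = a" unfolding homeomorphism_def by blast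
  hence inj: "inj_on (rng G) U" by (rule inj_on_inverseI)
  have "open (U \<inter> rng G -` U)"
    by (intro open_Int open_vimage U continuous_rng)
  moreover have "U \<inter> rng G -` U \<subseteq> units G"
  proof
    fix a assume "a \<in> U \<inter> rng G -` U"
    hence *: "rng G a \<in> U" "a \<in> U" by blast+
    have "rng G a = a" by (rule inj_onD[OF inj rng_rng *])
    thus "a \<in> units G" by (simp only: units_iff_rng)
  qed
  ultimately show "\<exists>T. open T \<and> x \<in> T \<and> T \<subseteq> units G"
    using U rng_unit[OF x] by (intro exI[of _ "U \<inter> rng G -` U"] conjI) simp_all
qed

lemma closed_units: "closed (units G)"
proof -
  have "units G = {a. rng G a = a}" by (auto simp: units_iff_rng)
  thus ?thesis by (simp add: closed_Collect_eq continuous_rng)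
qed

lemma closed_rfibre: "closed (rfibre G x)"
  unfolding rfibre_def by (simp add: closed_Collect_eq continuous_rng)

text \<open>A bisection here is an open set on which \<open>rng G\<close> is injective with open
  image. The section \<open>g\<close> later selects, continuously, its one arrow in a given
  fibre.\<close>

lemma bisection_exists:
  obtains U g where "open U" "a \<in> U" "inj_on (rng G) U" "open (rng G ` U)"
    "continuous_on (rng G ` U) g" "\<And>x. x \<in> U \<Longrightarrow> g (rng G x) = x"
proof -
  obtain U g where U: "open U" "a \<in> U" "openin (top_of_set (units G)) (rng G ` U)"
    and g: "homeomorphism U (rng G ` U) (rng G) g"
    using etale unfolding local_homeomorphism_onto_def by metis
  have "inj_on (rng G) U"
    by (rule inj_on_inverseI[of _ g]) (use g in \<open>simp add: homeomorphism_def\<close>)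
  moreover have "open (rng G ` U)"
    using U(3) open_units openin_open_eq by blast
  moreover have "continuous_on (rng G ` U) g" "\<And>x. x \<in> U \<Longrightarrow> g (rng G x) = x"
    using g unfolding homeomorphism_def by auto
  ultimately show thesis using U that by blast
qed

lemma isolated_in_rfibre:
  obtains U where "open U" "a \<in> U" "U \<inter> rfibre G (rng G a) = {a}"
proof -
  obtain U g where U: "open U" "a \<in> U" "inj_on (rng G) U" "open (rng G ` U)"
    "continuous_on (rng G ` U) g" "\<And>x. x \<in> U \<Longrightarrow> g (rng G x) = x"
    using bisection_exists[where a=a] by blast
  show thesis
    by (rule that[OF U(1,2)]) (use U(2,3) in \<open>auto simp: rfibre_def inj_on_def\<close>)
qed

text \<open>A neighbourhood isolating a point of the fibre contains no other point of it, so the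
  centres of a finite subcover exhaust the intersection.\<close>

lemma finite_compact_rfibre:
  assumes "compact C"
  shows "finite (C \<inter> rfibre G x)"
proof -
  have "\<forall>a. \<exists>U. open U \<and> a \<in> U \<and> (U \<inter> rfibre G (rng G a) = {a})"
    by (metis isolated_in_rfibre)
  then obtain U where U: "\<And>a. open (U a)" "\<And>a. a \<in> U a"
      "\<And>a. U a \<inter> rfibre G (rng G a) = {a}" by metis
  have "compact (C \<inter> rfibre G x)" using assms closed_rfibre by (rule compact_Int_closed)
  then obtain S where S: "S \<subseteq> C \<inter> rfibre G x" "finite S" "C \<inter> rfibre G x \<subseteq> (\<Union>c\<in>S. U c)"
    by (rule compactE_image[where f=U and C="C \<inter> rfibre G x"]) (use U in auto)
  have "C \<inter> rfibre G x \<subseteq> S"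
  proof
    fix a assume a: "a \<in> C \<inter> rfibre G x"
    then obtain c where c: "c \<in> S" "a \<in> U c" using S by auto
    hence "rng G c = rng G a" using S a by (auto simp: rfibre_def)
    hence "a = c" using U(3)[of c] c(2) by (auto simp: rfibre_def)
    thus "a \<in> S" using c by simp
  qed
  thus ?thesis using S(2) finite_subset by blast
qed

text \<open>Locally compact Hausdorff spaces are completely regular. Separating \<open>a\<close>
  from the complement of a \<open>W\<close> that sits in a compact \<open>C\<close> within
  \<open>U\<close> also controls the support.\<close>

lemma bump_exists:
  assumes "open U" "a \<in> U"
  obtains f :: "'a \<Rightarrow> real" where "continuous_on UNIV f" "\<And>x. 0 \<le> f x" "\<And>x. f x \<le> 1" "f a = 1"
    "compact (supp (\<lambda>x. of_real (f x)))" "supp (\<lambda>x. of_real (f x)) \<subseteq> U"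
    "\<And>x. x \<notin> U \<Longrightarrow> f x = 0"
proof -
  let ?E = "euclidean :: 'a topology"
  have haus: "Hausdorff_space ?E"
    unfolding Hausdorff_space_def disjnt_def using hausdorff by auto
  have reg: "regular_space ?E"
    using locally_compact haus locally_compact_Hausdorff_imp_regular_space by blast
  have cr: "completely_regular_space ?E"
    using locally_compact reg locally_compact_regular_imp_completely_regular_space by blast
  have "neighbourhood_base_of (\<lambda>C. compactin ?E C \<and> closedin ?E C) ?E"
    using locally_compact reg locally_compact_regular_space_neighbourhood_base by blast
  then obtain W C where W: "open W" "a \<in> W" "W \<subseteq> C" "C \<subseteq> U" "compact C" "closed C"
    using assms unfolding neighbourhood_base_of by (auto simp: Bex_def) metis
  obtain f :: "'a \<Rightarrow> real" where f: "continuous_map ?E (top_of_set {0..1}) f" "f a = 0" "f ` (- W) \<subseteq> {1}"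
    using cr W unfolding completely_regular_space_def
    by (elim allE[of _ "- W"] allE[of _ a]) (auto simp: closed_def)
  have cf: "continuous_on UNIV f" and rf: "\<And>x. f x \<in> {0..1}"
    using f(1) by (auto simp: continuous_map_in_subtopology)
  let ?g = "\<lambda>x. 1 - f x"
  have z: "?g x = 0" if "x \<notin> W" for x using f(3) that by auto
  have s: "supp (\<lambda>x. of_real (?g x) :: complex) \<subseteq> C"
    using W z by (intro supp_subset_closed) auto
  show thesis
  proof (rule that[of ?g])
    show "continuous_on UNIV ?g" by (intro continuous_intros cf)
    show "compact (supp (\<lambda>x. of_real (?g x)))" by (rule compact_supp_subset[OF \<open>compact C\<close> s])
    show "supp (\<lambda>x. of_real (?g x)) \<subseteq> U" using s W by auto
    show "?g x = 0" if "x \<notin> U" for x using z W that by auto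
  qed (use rf f(2) in auto)
qed

end

section \<open>Haar systems on etale groupoids\<close>

locale etale_haar = lch_etale_groupoid G + fully_supported_haar_system K G \<mu>
  for K :: "complex set" and G :: "'a::t2_space groupoid_ops" and \<mu> :: "'a \<Rightarrow> 'a measure" +
  assumes scalars: "K = \<real> \<or> K = UNIV"
begin

section \<open>Operations and separation in \<open>Cc K\<close> and its diagonal part\<close>

lemma scalars_closed [simp, intro]:
  "of_real r \<in> K" "0 \<in> K" "1 \<in> K"
  "a \<in> K \<Longrightarrow> b \<in> K \<Longrightarrow> a + b \<in> K" "a \<in> K \<Longrightarrow> b \<in> K \<Longrightarrow> a - b \<in> K"
  "a \<in> K \<Longrightarrow> b \<in> K \<Longrightarrow> a * b \<in> K" "a \<in> K \<Longrightarrow> b \<in> K \<Longrightarrow> a / b \<in> K"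
  "a \<in> K \<Longrightarrow> - a \<in> K" "a \<in> K \<Longrightarrow> cnj a \<in> K"
  using scalars by (auto simp: Reals_cnj_iff)

lemma Cc_add: "f \<in> Cc K \<Longrightarrow> g \<in> Cc K \<Longrightarrow> (\<lambda>a. f a + g a) \<in> Cc K"
proof (rule Cc_I)
  assume *: "f \<in> Cc K" "g \<in> Cc K"
  have "compact (supp f \<union> supp g)" using * by (intro compact_Un Cc_compact_supp)
  moreover have "supp (\<lambda>a. f a + g a) \<subseteq> supp f \<union> supp g"
  proof (rule supp_subset_closed)
    show "a \<in> supp f \<union> supp g" if "f a + g a \<noteq> 0" for a
      using that by (rule contrapos_np) (simp add: zero_off_supp)
  qed (simp add: supp_def closed_Un)
  ultimately show "compact (supp (\<lambda>a. f a + g a))" by (rule compact_supp_subset)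
  show "range (\<lambda>a. f a + g a) \<subseteq> K" using Cc_in[OF *(1)] Cc_in[OF *(2)] by auto
  show "continuous_on UNIV (\<lambda>a. f a + g a)"
    using * by (intro continuous_intros Cc_continuous[of _ K])
qed

lemma Cc_cmult: "c \<in> K \<Longrightarrow> f \<in> Cc K \<Longrightarrow> (\<lambda>a. c * f a) \<in> Cc K"
  by (rule Cc_dominated[of f K]) (auto intro!: continuous_intros Cc_continuous[of f K] intro: Cc_in)

lemma Cc_diff: "f \<in> Cc K \<Longrightarrow> g \<in> Cc K \<Longrightarrow> (\<lambda>a. f a - g a) \<in> Cc K"
  using Cc_add[of f "\<lambda>a. -1 * g a"] Cc_cmult[of "-1" g] by simp

lemma Cc_zero: "(\<lambda>a. 0) \<in> Cc K"
  by (rule Cc_I) (auto simp: supp_def)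

lemma Cc_mult_continuous:
  assumes "f \<in> Cc K" "continuous_on UNIV g" "\<And>a. g a \<in> K"
  shows "(\<lambda>a. g a * f a) \<in> Cc K"
  by (rule Cc_dominated[OF assms(1)])
    (use assms in \<open>auto intro!: continuous_intros Cc_continuous[OF assms(1)] intro: Cc_in\<close>)

lemma Cc_norm: "f \<in> Cc K \<Longrightarrow> (\<lambda>a. of_real (norm (f a))) \<in> Cc K"
  by (rule Cc_dominated[of f K]) (auto intro!: continuous_intros Cc_continuous[of f K])

lemma Cc_bump:
  fixes U :: "'a set"
  assumes "open U" "a \<in> U"
  obtains f where "f \<in> Cc K" "f a = 1" "\<And>x. x \<notin> U \<Longrightarrow> f x = 0" "\<And>x. norm (f x) \<le> 1" "supp f \<subseteq> U"
proof -
  obtain f :: "_ \<Rightarrow> real" where f: "continuous_on UNIV f" "\<And>x. 0 \<le> f x" "\<And>x. f x \<le> 1" "f a = 1"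
    "compact (supp (\<lambda>x. of_real (f x)))" "supp (\<lambda>x. of_real (f x)) \<subseteq> U"
    "\<And>x. x \<notin> U \<Longrightarrow> f x = 0"
    using bump_exists[OF assms] by metis
  show thesis
    by (rule that[of "\<lambda>x. of_real (f x)"]) (use f in \<open>auto intro!: Cc_I continuous_intros\<close>)
qed

lemma Cc_separates:
  fixes a b :: 'a
  assumes "a \<noteq> b"
  obtains f where "f \<in> Cc K" "f a = 1" "f b = 0"
proof -
  have "open (- {b})" "a \<in> - {b}" using assms by (auto simp: open_Compl)
  then obtain f where "f \<in> Cc K" "f a = 1" "\<And>x. x \<notin> - {b} \<Longrightarrow> f x = 0"
    using Cc_bump by metis
  thus thesis using that by auto
qed

lemma Cc_nonvanishing:
  fixes a :: 'a
  obtains f where "f \<in> Cc K" "f a = 1"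
  using Cc_bump[OF open_UNIV UNIV_I] by metis

lemma Cc_diag_iff: "f \<in> Cc_diag K G \<longleftrightarrow> f \<in> Cc K \<and> (\<forall>a. a \<notin> units G \<longrightarrow> f a = 0)"
  unfolding Cc_diag_def
  using supp_subset_closed[OF closed_units, of f] nonzero_in_supp[of f] by blast

lemma Cc_diagD: "f \<in> Cc_diag K G \<Longrightarrow> f \<in> Cc K" "f \<in> Cc_diag K G \<Longrightarrow> a \<notin> units G \<Longrightarrow> f a = 0"
  by (auto simp: Cc_diag_iff)

lemma diag_bump:
  assumes "open U" "x \<in> U" "x \<in> units G"
  obtains d where "d \<in> Cc_diag K G" "d x = 1" "\<And>y. y \<notin> U \<Longrightarrow> d y = 0" "\<And>y. norm (d y) \<le> 1"
proof -
  obtain d where d: "d \<in> Cc K" "d x = 1" "\<And>y. y \<notin> U \<inter> units G \<Longrightarrow> d y = 0" "\<And>y. norm (d y) \<le> 1"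
    using Cc_bump[of "U \<inter> units G" x] assms open_units by (metis IntI open_Int)
  thus thesis using that by (auto simp: Cc_diag_iff)
qed

lemma Cc_diag_nonvanishing:
  assumes "x \<in> units G"
  obtains d where "d \<in> Cc_diag K G" "d x = 1"
  using diag_bump[OF open_UNIV UNIV_I assms] by metis

section \<open>Haar measures as sums of point masses\<close>

lemma sets_haar: "x \<in> units G \<Longrightarrow> sets (\<mu> x) = sets borel"
  using regular by (simp add: regular_borel_measure_def)

lemma space_haar: "x \<in> units G \<Longrightarrow> space (\<mu> x) = UNIV"
  using sets_eq_imp_space_eq[OF sets_haar] by simp

text \<open>Without second countability the complement of a support can have positive measure. The
  complement of the fibre is open, so by regularity its measure is a supremum over compact subsets,
  and each of them is covered by finitely many open null sets.\<close>

lemma haar_null_off_fibre: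
  assumes x: "x \<in> units G"
  shows "emeasure (\<mu> x) (- rfibre G x) = 0"
proof -
  have "emeasure (\<mu> x) C = 0" if C: "compact C" "C \<subseteq> - rfibre G x" for C
  proof -
    have "\<forall>a\<in>C. \<exists>U. open U \<and> a \<in> U \<and> emeasure (\<mu> x) U = 0"
      
    proof
      fix a assume "a \<in> C"
      hence "a \<notin> measure_supp (\<mu> x)" using C(2) supp_subset[OF x] by blast
      thus "\<exists>U. open U \<and> a \<in> U \<and> emeasure (\<mu> x) U = 0"
        unfolding measure_supp_def using not_gr_zero by blast
    qed
    then obtain U where U: "\<And>a. a \<in> C \<Longrightarrow> open (U a) \<and> a \<in> U a \<and> emeasure (\<mu> x) (U a) = 0"
      by metis
    obtain S where S: "S \<subseteq> C" "finite S" "C \<subseteq> (\<Union>c\<in>S. U c)"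
      by (rule compactE_image[OF C(1), of C U]) (use U in auto)
    have "emeasure (\<mu> x) C \<le> emeasure (\<mu> x) (\<Union>c\<in>S. U c)"
    proof (rule emeasure_mono)
      have "open (\<Union>c\<in>S. U c)" using S U by blast
      thus "(\<Union>c\<in>S. U c) \<in> sets (\<mu> x)" by (simp add: sets_haar[OF x])
    qed (rule S(3))
    also have "\<dots> \<le> (\<Sum>c\<in>S. emeasure (\<mu> x) (U c))"
      using S U by (intro emeasure_subadditive_finite) (auto simp: sets_haar[OF x])
    also have "\<dots> = 0" using S U by (auto intro!: sum.neutral)
    finally show ?thesis by simp
  qed
  moreover have "emeasure (\<mu> x) (- rfibre G x)
      = (SUP C \<in> {C. compact C \<and> C \<subseteq> - rfibre G x}. emeasure (\<mu> x) C)"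
    using regular[OF x, unfolded regular_borel_measure_def, THEN conjunct2, THEN conjunct2,
        THEN conjunct2, THEN spec] open_Compl[OF closed_rfibre] by (rule mp)
  ultimately show ?thesis by (auto intro!: SUP_eq_const)
qed

lemma AE_in_rfibre: "x \<in> units G \<Longrightarrow> AE a in \<mu> x. a \<in> rfibre G x"
  by (rule AE_I'[of "- rfibre G x"])
    (auto simp: null_sets_def haar_null_off_fibre sets_haar closed_rfibre open_Compl)

definition mass :: "'a \<Rightarrow> real" where
  "mass a = measure (\<mu> (rng G a)) {a}"

lemma emeasure_singleton_finite: "x \<in> units G \<Longrightarrow> emeasure (\<mu> x) {a} < \<infinity>"
  using regular[of x, unfolded regular_borel_measure_def, THEN conjunct2, THEN conjunct1,
      THEN spec, THEN mp] by simp

lemma emeasure_singleton: "emeasure (\<mu> (rng G a)) {a} = ennreal (mass a)"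
  unfolding mass_def
  using emeasure_singleton_finite[of "rng G a" a] by (simp add: emeasure_eq_ennreal_measure less_top)

text \<open>Full support makes every neighbourhood of \<open>a\<close> positive; an isolating one
  exceeds \<open>{a}\<close> only by points off the fibre, which are null.\<close>

lemma mass_pos: "0 < mass a"
proof -
  let ?x = "rng G a"
  obtain U where U: "open U" "a \<in> U" "U \<inter> rfibre G ?x = {a}"
    using isolated_in_rfibre[of a] by metis
  have "a \<in> measure_supp (\<mu> ?x)"
    using fully_supported[of ?x] by (simp add: rfibre_def)
  hence "0 < emeasure (\<mu> ?x) U" using U by (auto simp: measure_supp_def)
  also have "\<dots> \<le> emeasure (\<mu> ?x) ({a} \<union> - rfibre G ?x)"
    using U by (intro emeasure_mono) (auto simp: sets_haar closed_rfibre open_Compl)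
  also have "\<dots> \<le> emeasure (\<mu> ?x) {a} + emeasure (\<mu> ?x) (- rfibre G ?x)"
    by (intro emeasure_subadditive) (auto simp: sets_haar closed_rfibre open_Compl)
  finally show ?thesis by (simp add: haar_null_off_fibre emeasure_singleton)
qed

lemma mass_nonneg: "0 \<le> mass a" and mass_nonzero: "mass a \<noteq> 0"
  using mass_pos[of a] by auto

text \<open>Left translation by \<open>a\<close> carries the point \<open>src G a\<close> to
  \<open>a\<close>, and singletons are compact.\<close>

lemma mass_src: "mass (src G a) = mass a"
proof -
  have "emeasure (\<mu> (rng G a)) (gmult G a ` {src G a}) = emeasure (\<mu> (src G a)) {src G a}"
    by (rule left_invariant) (auto simp: rfibre_def)
  thus ?thesis by (simp add: gmult_src mass_def measure_def)
qed

lemma has_integral_finite: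
  fixes f :: "'a \<Rightarrow> 'b::{banach, second_countable_topology}"
  assumes x: "x \<in> units G" and S: "finite S" "S \<subseteq> rfibre G x" and f: "\<And>a. a \<notin> S \<Longrightarrow> f a = 0"
  shows "has_bochner_integral (\<mu> x) f (\<Sum>a\<in>S. mass a *\<^sub>R f a)"
proof -
  have "has_bochner_integral (\<mu> x) (\<lambda>a. \<Sum>s\<in>S. indicator {s} a *\<^sub>R f s) (\<Sum>s\<in>S. measure (\<mu> x) {s} *\<^sub>R f s)"
    by (intro has_bochner_integral_sum has_bochner_integral_indicator)
      (use emeasure_singleton_finite[OF x] in \<open>auto simp: sets_haar x\<close>)
  moreover have "(\<lambda>a. \<Sum>s\<in>S. indicator {s} a *\<^sub>R f s) = f"
  proof
    fix a
    have "(\<Sum>s\<in>S. indicator {s} a *\<^sub>R f s) = (\<Sum>s\<in>S. if a = s then f s else 0)"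
      by (intro sum.cong) auto
    thus "(\<Sum>s\<in>S. indicator {s} a *\<^sub>R f s) = f a" using f S by (auto simp: sum.delta)
  qed
  moreover have "measure (\<mu> x) {s} = mass s" if "s \<in> S" for s
    using that S by (auto simp: mass_def rfibre_def)
  ultimately show ?thesis by simp
qed

text \<open>Off the fibre \<open>f\<close> may be nonzero, so it equals a finitely supported
  function only almost everywhere; continuity supplies the measurability for this
  replacement.\<close>

lemma has_integral_fibre_finite:
  fixes f :: "'a \<Rightarrow> 'b::{banach, second_countable_topology}"
  assumes x: "x \<in> units G" and S: "finite S" "S \<subseteq> rfibre G x"
    and f: "\<And>a. a \<in> rfibre G x \<Longrightarrow> a \<notin> S \<Longrightarrow> f a = 0" and m: "continuous_on UNIV f"
  shows "has_bochner_integral (\<mu> x) f (\<Sum>a\<in>S. mass a *\<^sub>R f a)"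
proof -
  let ?g = "\<lambda>a. if a \<in> S then f a else 0"
  have g: "has_bochner_integral (\<mu> x) ?g (\<Sum>a\<in>S. mass a *\<^sub>R ?g a)"
    by (rule has_integral_finite) (use x S in auto)
  have "has_bochner_integral (\<mu> x) f (\<Sum>a\<in>S. mass a *\<^sub>R ?g a)"
  proof (subst has_bochner_integral_cong_AE[where g = ?g])
    show "f \<in> borel_measurable (\<mu> x)"
      using borel_measurable_continuous_onI[OF m] measurable_cong_sets[OF sets_haar[OF x] refl] by blast
    show "AE a in \<mu> x. f a = ?g a"
      using AE_in_rfibre[OF x] by eventually_elim (use f in auto)
  qed (use g in \<open>auto simp: has_bochner_integral_iff\<close>)
  moreover have "(\<Sum>a\<in>S. mass a *\<^sub>R ?g a) = (\<Sum>a\<in>S. mass a *\<^sub>R f a)"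
    by (intro sum.cong) simp_all
  ultimately show ?thesis by (simp only:)
qed

lemma integral_fibre:
  fixes f :: "'a \<Rightarrow> complex"
  assumes "x \<in> units G" "finite S" "S \<subseteq> rfibre G x"
    "\<And>a. a \<in> rfibre G x \<Longrightarrow> a \<notin> S \<Longrightarrow> f a = 0" "f \<in> Cc K"
  shows "integral\<^sup>L (\<mu> x) f = (\<Sum>a\<in>S. of_real (mass a) * f a)"
proof -
  have "has_bochner_integral (\<mu> x) f (\<Sum>a\<in>S. mass a *\<^sub>R f a)"
    by (rule has_integral_fibre_finite) (use assms Cc_continuous in auto)
  from has_bochner_integral_integral_eq[OF this] show ?thesis by (simp add: scaleR_conv_of_real)
qed

section \<open>Norms on single fibres\<close>

definition fibre_norm :: "('a \<Rightarrow> complex) \<Rightarrow> 'a \<Rightarrow> real" where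
  "fibre_norm f x = (LINT a|\<mu> x. norm (f a))"

lemma fibre_norm_eq:
  assumes "x \<in> units G" "finite S" "S \<subseteq> rfibre G x"
    "\<And>a. a \<in> rfibre G x \<Longrightarrow> a \<notin> S \<Longrightarrow> f a = 0" "f \<in> Cc K"
  shows "fibre_norm f x = (\<Sum>a\<in>S. mass a * norm (f a))"
proof -
  have "has_bochner_integral (\<mu> x) (\<lambda>a. norm (f a)) (\<Sum>a\<in>S. mass a *\<^sub>R norm (f a))"
    by (rule has_integral_fibre_finite) (use assms in \<open>auto intro!: continuous_intros Cc_continuous\<close>)
  from has_bochner_integral_integral_eq[OF this] show ?thesis by (simp add: fibre_norm_def)
qed

lemma finite_fibre_supp: "f \<in> Cc K \<Longrightarrow> finite (supp f \<inter> rfibre G x)"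
  by (intro finite_compact_rfibre Cc_compact_supp)

lemma fibre_norm_nonneg: "0 \<le> fibre_norm f x"
  unfolding fibre_norm_def by simp

lemma fibre_norm_ge:
  assumes "f \<in> Cc K"
  shows "mass a * norm (f a) \<le> fibre_norm f (rng G a)"
proof -
  let ?S = "insert a (supp f \<inter> rfibre G (rng G a))"
  have fin: "finite ?S" using finite_fibre_supp[OF assms] by simp
  have "fibre_norm f (rng G a) = (\<Sum>b\<in>?S. mass b * norm (f b))"
    by (rule fibre_norm_eq) (use fin assms in \<open>auto simp: rfibre_def zero_off_supp\<close>)
  also have "\<dots> \<ge> (\<Sum>b\<in>{a}. mass b * norm (f b))"
    by (rule sum_mono2) (use fin mass_nonneg in auto)
  finally show ?thesis by simp
qed

lemma fibre_norm_continuous: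
  assumes "f \<in> Cc K"
  shows "continuous_on (units G) (fibre_norm f)"
proof -
  have "continuous_on (units G) (\<lambda>x. Re (LINT a|\<mu> x. complex_of_real (norm (f a))))"
    by (intro continuous_intros continuous_integral Cc_norm assms)
  thus ?thesis by (simp add: fibre_norm_def[abs_def])
qed

text \<open>The real supremum in \<open>Ir_norm\<close> bounds its terms only once they are bounded
  above. They are continuous on the compact image of the support under \<open>rng G\<close> and
  vanish elsewhere.\<close>

lemma fibre_norm_bdd:
  assumes f: "f \<in> Cc K"
  shows "bdd_above (fibre_norm f ` units G)"
proof -
  let ?C = "rng G ` supp f"
  have "compact ?C"
    by (intro compact_continuous_image continuous_rng Cc_compact_supp[OF f])
  hence "compact (fibre_norm f ` ?C)"
    by (rule compact_continuous_image[OF continuous_on_subset[OF fibre_norm_continuous[OF f]], rotated]) auto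
  then obtain B where B: "\<And>y. y \<in> fibre_norm f ` ?C \<Longrightarrow> y \<le> B"
    using bounded_imp_bdd_above[OF compact_imp_bounded] unfolding bdd_above_def by metis
  have "fibre_norm f x \<le> max 0 B" if x: "x \<in> units G" for x
  proof (cases "x \<in> ?C")
    case True thus ?thesis using B by fastforce
  next
    case False
    hence "fibre_norm f x = (\<Sum>a\<in>{}. mass a * norm (f a))"
      by (intro fibre_norm_eq) (use x f zero_off_supp[of _ f] in \<open>auto simp: rfibre_def\<close>)
    thus ?thesis by simp
  qed
  thus ?thesis by (auto intro!: bdd_aboveI)
qed

lemma fibre_norm_le_Ir_norm: "f \<in> Cc K \<Longrightarrow> x \<in> units G \<Longrightarrow> fibre_norm f x \<le> Ir_norm G \<mu> f"
  unfolding Ir_norm_def using cSUP_upper[OF _ fibre_norm_bdd, of x f] by (simp add: fibre_norm_def)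

lemma Ir_norm_le: "(\<And>x. x \<in> units G \<Longrightarrow> fibre_norm f x \<le> B) \<Longrightarrow> Ir_norm G \<mu> f \<le> B"
  unfolding Ir_norm_def fibre_norm_def using rng_in_units by (intro cSUP_least) blast+

section \<open>Convolutions as finite sums\<close>

lemma convolution_eq:
  assumes "finite S" "S \<subseteq> rfibre G (rng G a)"
    "\<And>s. rng G s = rng G a \<Longrightarrow> s \<notin> S \<Longrightarrow> f s * g (gmult G (ginv G s) a) = 0"
  shows "convolution G \<mu> f g a = (\<Sum>s\<in>S. of_real (mass s) * (f s * g (gmult G (ginv G s) a)))"
proof -
  \<comment> \<open>The indicator makes the integrand vanish off the finite set, so it is a finite
    combination of point indicators and its integrability is automatic.\<close>
  let ?F = "\<lambda>s. indicator (rfibre G (rng G a)) s *\<^sub>R (f s * g (gmult G (ginv G s) a))"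
  have "has_bochner_integral (\<mu> (rng G a)) ?F (\<Sum>s\<in>S. mass s *\<^sub>R ?F s)"
    by (rule has_integral_finite) (use assms in \<open>auto simp: rfibre_def indicator_def\<close>)
  hence "convolution G \<mu> f g a = (\<Sum>s\<in>S. mass s *\<^sub>R ?F s)"
    unfolding convolution_def set_lebesgue_integral_def by (rule has_bochner_integral_integral_eq)
  also have "\<dots> = (\<Sum>s\<in>S. of_real (mass s) * (f s * g (gmult G (ginv G s) a)))"
    using assms by (intro sum.cong) (auto simp: scaleR_conv_of_real)
  finally show ?thesis .
qed

lemma convolution_single:
  assumes "rng G b = rng G a"
    "\<And>s. rng G s = rng G a \<Longrightarrow> s \<noteq> b \<Longrightarrow> f s * g (gmult G (ginv G s) a) = 0"
  shows "convolution G \<mu> f g a = of_real (mass b) * (f b * g (gmult G (ginv G b) a))"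
  using convolution_eq[of "{b}" a f g] assms by (auto simp: rfibre_def)

lemma convolution_diag_left:
  assumes "d \<in> Cc_diag K G"
  shows "convolution G \<mu> d f a = of_real (mass (rng G a)) * (d (rng G a) * f a)"
proof -
  have "convolution G \<mu> d f a
      = of_real (mass (rng G a)) * (d (rng G a) * f (gmult G (ginv G (rng G a)) a))"
  proof (rule convolution_single)
    fix s assume "rng G s = rng G a" "s \<noteq> rng G a"
    hence "s \<notin> units G" by (metis rng_unit)
    thus "d s * f (gmult G (ginv G s) a) = 0" using Cc_diagD[OF assms] by simp
  qed simp
  thus ?thesis by (simp add: ginv_unit gmult_rng)
qed

lemma convolution_diag_right:
  assumes "d \<in> Cc_diag K G"
  shows "convolution G \<mu> f d a = of_real (mass (src G a)) * (f a * d (src G a))"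
proof -
  have "convolution G \<mu> f d a = of_real (mass a) * (f a * d (gmult G (ginv G a) a))"
  proof (rule convolution_single)
    fix s assume "rng G s = rng G a" "s \<noteq> a"
    hence "gmult G (ginv G s) a \<notin> units G" using ginv_gmult_unit_iff by metis
    thus "f s * d (gmult G (ginv G s) a) = 0" using Cc_diagD[OF assms] by simp
  qed simp
  thus ?thesis by (simp add: mass_src src_def[symmetric])
qed

text \<open>The integral of a diagonal function \<open>f\<close> over the fibre of a unit sees only
  the atom at that unit. Near a unit \<open>mass\<close> is thus a Haar integral divided by
  \<open>f\<close>; on all arrows it is this function of the unit composed with
  \<open>src G\<close>.\<close>

lemma continuous_mass: "continuous_on UNIV mass"
proof -
  have "isCont mass x" if x: "x \<in> units G" for x
  proof -
    obtain f where f: "f \<in> Cc_diag K G" "f x = 1"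
      using Cc_diag_nonvanishing[OF x] by blast
    have fC: "f \<in> Cc K" using Cc_diagD(1)[OF f(1)] .
    let ?V = "units G \<inter> {y. f y \<noteq> 0}"
    have opV: "open ?V"
      by (intro open_Int open_units continuous_on_nonzero_open Cc_continuous[OF fC])
    have int: "integral\<^sup>L (\<mu> y) f = of_real (mass y) * f y" if y: "y \<in> units G" for y
    proof -
      have "f a = 0" if "a \<in> rfibre G y" "a \<notin> {y}" for a
        using that rng_unit by (intro Cc_diagD(2)[OF f(1)]) (auto simp: rfibre_def)
      hence "integral\<^sup>L (\<mu> y) f = (\<Sum>a\<in>{y}. of_real (mass a) * f a)"
        using y fC by (intro integral_fibre) (auto simp: rfibre_def rng_unit)
      thus ?thesis by simp
    qed
    have "continuous_on ?V (\<lambda>y. Re (integral\<^sup>L (\<mu> y) f / f y))"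
      by (intro continuous_intros continuous_on_subset[OF continuous_integral[OF fC]]
          continuous_on_subset[OF Cc_continuous[OF fC]]) auto
    hence "continuous_on ?V mass"
      by (rule continuous_on_eq) (auto simp: int)
    moreover have "x \<in> ?V" using x f(2) by simp
    ultimately show ?thesis using continuous_on_eq_continuous_at[OF opV, of mass] by blast
  qed
  hence c: "continuous_on (units G) mass" by (intro continuous_at_imp_continuous_on) auto
  have "continuous_on UNIV (\<lambda>a. mass (src G a))"
    by (rule continuous_on_compose2[OF c continuous_src]) auto
  thus ?thesis by (simp add: mass_src)
qed

end

text \<open>Additivity settles countable \<open>E\<close>. An uncountable \<open>E\<close> whose
  points all have positive mass has infinite measure for both: if it were finite, only finitely many
  points could have mass at least \<open>1 / Suc n\<close>, and these sets exhaust
  \<open>E\<close>.\<close>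

lemma measure_eq_of_singletons:
  assumes sets: "sets M = sets N" and E: "E \<in> sets M" and single: "\<And>F. F \<subseteq> E \<Longrightarrow> countable F \<Longrightarrow> F \<in> sets M"
    and eq: "\<And>a. a \<in> E \<Longrightarrow> emeasure M {a} = emeasure N {a}"
    and pos: "\<And>a. a \<in> E \<Longrightarrow> 0 < emeasure M {a}"
  shows "emeasure M E = emeasure N E"
proof (cases "countable E")
  case True
  have "emeasure M E = (\<integral>\<^sup>+a. emeasure M {a} \<partial>count_space E)"
    by (rule emeasure_countable_singleton) (use True single in auto)
  also have "\<dots> = (\<integral>\<^sup>+a. emeasure N {a} \<partial>count_space E)"
    using eq by (intro nn_integral_cong) auto
  also have "\<dots> = emeasure N E"
    by (rule emeasure_countable_singleton[symmetric]) (use True single sets in auto)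
  finally show ?thesis .
next
  case False
  have infinite: "emeasure L E = \<infinity>"
    if L: "sets L = sets M" "\<And>a. a \<in> E \<Longrightarrow> 0 < emeasure L {a}" for L
  proof (rule ccontr)
    assume "emeasure L E \<noteq> \<infinity>"
    then obtain B where B: "emeasure L E = ennreal B" "0 \<le> B" by (cases "emeasure L E") auto
    let ?A = "\<lambda>n::nat. {a \<in> E. ennreal (1 / Suc n) \<le> emeasure L {a}}"
    have fin: "finite (?A n)" for n
    proof (rule ccontr)
      assume inf: "infinite (?A n)"
      \<comment> \<open>Large enough that \<open>k\<close> points of mass at least
        \<open>1 / Suc n\<close> weigh more than \<open>B\<close>.\<close>
      define k where "k = nat \<lceil>B * Suc n\<rceil> + 1"
      obtain F where F: "F \<subseteq> ?A n" "finite F" "card F = k"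
        using infinite_arbitrarily_large[OF inf] by metis
      have "ennreal (k * (1 / Suc n)) = (\<Sum>a\<in>F. ennreal (1 / Suc n))"
        using F by (simp add: ennreal_mult[symmetric] ennreal_of_nat_eq_real_of_nat del: of_nat_Suc)
      also have "\<dots> \<le> (\<Sum>a\<in>F. emeasure L {a})" using F by (intro sum_mono) auto
      also have "\<dots> = emeasure L F"
        using F single L(1) by (intro emeasure_eq_sum_singleton[symmetric]) auto
      also have "\<dots> \<le> ennreal B" using F E L(1) by (auto simp: B(1)[symmetric] intro!: emeasure_mono)
      finally have "k * (1 / Suc n) \<le> B" using B(2) by (simp add: ennreal_le_iff)
      moreover have "B * Suc n < k" unfolding k_def by linarith
      ultimately show False by (simp add: field_simps)
    qed
    have "a \<in> (\<Union>n. ?A n)" if a: "a \<in> E" for a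
    proof -
      have "\<exists>n. ennreal (1 / Suc n) \<le> emeasure L {a}"
      proof (cases "emeasure L {a}")
        case (real r)
        hence "0 < r" using L(2)[OF a] by auto
        then obtain n where "inverse (real (Suc n)) < r" using reals_Archimedean by blast
        thus ?thesis using real by (intro exI[of _ n]) (auto simp: inverse_eq_divide)
      qed auto
      thus ?thesis using a by auto
    qed
    hence "E \<subseteq> (\<Union>n. ?A n)" by blast
    moreover have "countable (\<Union>n. ?A n)" using fin by (intro countable_UN) (auto intro: countable_finite)
    ultimately show False using False countable_subset by blast
  qed
  have "emeasure M E = \<infinity>" using pos by (intro infinite) auto
  moreover have "emeasure N E = \<infinity>"
  proof (rule infinite)
    show "0 < emeasure N {a}" if "a \<in> E" for a using eq[OF that] pos[OF that] by simp
  qed (simp add: sets)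
  ultimately show ?thesis by simp
qed

section \<open>Convolution with diagonal functions\<close>

context etale_haar
begin

lemma Cc_diag_add: "d \<in> Cc_diag K G \<Longrightarrow> e \<in> Cc_diag K G \<Longrightarrow> (\<lambda>a. d a + e a) \<in> Cc_diag K G"
  by (auto simp: Cc_diag_iff intro!: Cc_add)

lemma Cc_diag_cmult: "c \<in> K \<Longrightarrow> d \<in> Cc_diag K G \<Longrightarrow> (\<lambda>a. c * d a) \<in> Cc_diag K G"
  by (auto simp: Cc_diag_iff intro!: Cc_cmult)

lemma Cc_diag_mult_continuous:
  assumes "d \<in> Cc_diag K G" "continuous_on UNIV g" "\<And>a. g a \<in> K"
  shows "(\<lambda>a. g a * d a) \<in> Cc_diag K G"
  using Cc_mult_continuous[of d g] assms by (auto simp: Cc_diag_iff)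

lemma convolution_diag_left_Cc:
  assumes "d \<in> Cc_diag K G" "f \<in> Cc K"
  shows "convolution G \<mu> d f \<in> Cc K"
proof -
  note d = Cc_diagD(1)[OF assms(1)]
  have c: "continuous_on UNIV (\<lambda>a. of_real (mass (rng G a)) * d (rng G a))"
    by (intro continuous_intros continuous_on_compose2[OF continuous_mass continuous_rng]
        continuous_on_compose2[OF Cc_continuous[OF d] continuous_rng]) auto
  have "(\<lambda>a. (of_real (mass (rng G a)) * d (rng G a)) * f a) \<in> Cc K"
    by (rule Cc_mult_continuous[OF assms(2) c]) (use Cc_in[OF d] in auto)
  moreover have "convolution G \<mu> d f = (\<lambda>a. (of_real (mass (rng G a)) * d (rng G a)) * f a)"
    using convolution_diag_left[OF assms(1)] by (intro ext) (simp add: mult.assoc)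
  ultimately show ?thesis by simp
qed

lemma convolution_diag_right_Cc:
  assumes "d \<in> Cc_diag K G" "f \<in> Cc K"
  shows "convolution G \<mu> f d \<in> Cc K"
proof -
  note d = Cc_diagD(1)[OF assms(1)]
  have c: "continuous_on UNIV (\<lambda>a. of_real (mass (src G a)) * d (src G a))"
    by (intro continuous_intros continuous_on_compose2[OF continuous_mass continuous_src]
        continuous_on_compose2[OF Cc_continuous[OF d] continuous_src]) auto
  have "(\<lambda>a. (of_real (mass (src G a)) * d (src G a)) * f a) \<in> Cc K"
    by (rule Cc_mult_continuous[OF assms(2) c]) (use Cc_in[OF d] in auto)
  moreover have "convolution G \<mu> f d = (\<lambda>a. (of_real (mass (src G a)) * d (src G a)) * f a)"
    using convolution_diag_right[OF assms(1)] by (intro ext) (simp add: mult.assoc mult.left_commute)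
  ultimately show ?thesis by simp
qed

text \<open>Multiplying by \<open>mass\<close> therefore turns diagonal convolution into the
  pointwise product; this is the origin of the masses in the description of \<open>T\<close> on
  units.\<close>

lemma convolution_diag_diag:
  assumes "d \<in> Cc_diag K G" "e \<in> Cc_diag K G"
  shows "convolution G \<mu> d e = (\<lambda>a. of_real (mass a) * (d a * e a))"
proof
  fix a
  show "convolution G \<mu> d e a = of_real (mass a) * (d a * e a)"
  proof (cases "a \<in> units G")
    case True
    thus ?thesis by (simp add: convolution_diag_left[OF assms(1)] rng_unit)
  next
    case False
    thus ?thesis by (simp add: convolution_diag_left[OF assms(1)] Cc_diagD(2)[OF assms(2)])
  qed
qed

lemma diag_separates:
  assumes "x \<in> units G" "x \<noteq> y"
  obtains d where "d \<in> Cc_diag K G" "d x = 1" "d y = 0"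
proof -
  have "open (- {y})" "x \<in> - {y}" using assms by (auto intro: open_Compl)
  then obtain d where "d \<in> Cc_diag K G" "d x = 1" "\<And>z. z \<notin> - {y} \<Longrightarrow> d z = 0"
    using diag_bump assms(1) by metis
  thus thesis using that by auto
qed

text \<open>Serves the localisation: a diagonal function acting from the left is a single scalar on
  each fibre.\<close>

lemma fibre_norm_mult_rng:
  assumes f: "f \<in> Cc K" and u: "\<And>a. rng G a = x \<Longrightarrow> g a = c * f a"
    and g: "g \<in> Cc K" and x: "x \<in> units G"
  shows "fibre_norm g x = norm c * fibre_norm f x"
proof -
  let ?S = "supp f \<inter> rfibre G x"
  have "fibre_norm g x = (\<Sum>a\<in>?S. mass a * norm (g a))"
    by (rule fibre_norm_eq) (use x g u zero_off_supp[of _ f] finite_fibre_supp[OF f] in \<open>auto simp: rfibre_iff\<close>)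
  also have "\<dots> = (\<Sum>a\<in>?S. norm c * (mass a * norm (f a)))"
    using u by (intro sum.cong) (auto simp: rfibre_def norm_mult)
  also have "\<dots> = norm c * (\<Sum>a\<in>?S. mass a * norm (f a))"
    by (rule sum_distrib_left[symmetric])
  also have "(\<Sum>a\<in>?S. mass a * norm (f a)) = fibre_norm f x"
    by (rule fibre_norm_eq[symmetric]) (use x f in \<open>auto simp: finite_fibre_supp zero_off_supp\<close>)
  finally show ?thesis .
qed

end

text \<open>Squaring and adding the two equations, the parallelogram law leaves only the cross term
  \<open>norm u * norm v\<close>.\<close>

lemma norm_add_diff_eq_imp_zero:
  fixes u v :: "'a::real_inner"
  assumes "norm (u + v) = norm u + norm v" "norm (u - v) = norm u + norm v"
  shows "u = 0 \<or> v = 0"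
proof -
  have "(norm (u + v))\<^sup>2 + (norm (u - v))\<^sup>2 = 2 * (norm u)\<^sup>2 + 2 * (norm v)\<^sup>2"
    by (simp add: power2_norm_eq_inner inner_add inner_diff inner_commute)
  hence "norm u * norm v = 0" unfolding assms by (simp add: power2_sum)
  thus ?thesis by simp
qed

section \<open>Disjoint supports, and test functions on bisections\<close>

context etale_haar
begin

text \<open>The right side speaks only of sums, differences and fibre norms, so a linear fibrewise
  isometry transports it. Equality of the sums forces equality in each triangle inequality, since
  every defect is nonnegative and carries a positive mass.\<close>

lemma fibre_disjoint_iff:
  assumes f: "f \<in> Cc K" and g: "g \<in> Cc K" and x: "x \<in> units G"
  shows "(\<forall>a. rng G a = x \<longrightarrow> f a = 0 \<or> g a = 0) \<longleftrightarrow>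
    fibre_norm (\<lambda>a. f a + g a) x = fibre_norm f x + fibre_norm g x \<and>
    fibre_norm (\<lambda>a. f a - g a) x = fibre_norm f x + fibre_norm g x" (is "?L \<longleftrightarrow> ?R")
proof -
  let ?S = "(supp f \<inter> rfibre G x) \<union> (supp g \<inter> rfibre G x)"
  have fin: "finite ?S" using finite_fibre_supp f g by blast
  have z: "f a = 0" "g a = 0" if "a \<in> rfibre G x" "a \<notin> ?S" for a
    using that zero_off_supp by auto
  have N: "fibre_norm k x = (\<Sum>a\<in>?S. mass a * norm (k a))"
    if "k \<in> Cc K" "\<And>a. a \<in> rfibre G x \<Longrightarrow> a \<notin> ?S \<Longrightarrow> k a = 0" for k
    by (rule fibre_norm_eq) (use x fin that in auto)
  have Nf: "fibre_norm f x = (\<Sum>a\<in>?S. mass a * norm (f a))" and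
    Ng: "fibre_norm g x = (\<Sum>a\<in>?S. mass a * norm (g a))"
    using N[OF f z(1)] N[OF g z(2)] by simp_all
  have Na: "fibre_norm (\<lambda>a. f a + g a) x = (\<Sum>a\<in>?S. mass a * norm (f a + g a))"
    by (rule N[OF Cc_add[OF f g]]) (simp add: z)
  have Nd: "fibre_norm (\<lambda>a. f a - g a) x = (\<Sum>a\<in>?S. mass a * norm (f a - g a))"
    by (rule N[OF Cc_diff[OF f g]]) (simp add: z)
  have defect: "fibre_norm f x + fibre_norm g x - (\<Sum>a\<in>?S. mass a * k a)
      = (\<Sum>a\<in>?S. mass a * (norm (f a) + norm (g a) - k a))" for k
    by (simp add: Nf Ng sum.distrib sum_subtractf ring_distribs)
  have zero_iff: "(\<Sum>a\<in>?S. mass a * (norm (f a) + norm (g a) - k a)) = 0 \<longleftrightarrow>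
      (\<forall>a\<in>?S. k a = norm (f a) + norm (g a))" if k: "\<And>a. k a \<le> norm (f a) + norm (g a)" for k
  proof -
    have "(\<Sum>a\<in>?S. mass a * (norm (f a) + norm (g a) - k a)) = 0 \<longleftrightarrow>
      (\<forall>a\<in>?S. mass a * (norm (f a) + norm (g a) - k a) = 0)"
      by (rule sum_nonneg_eq_0_iff[OF fin]) (use k mass_nonneg in \<open>simp add: mult_nonneg_nonneg\<close>)
    thus ?thesis by (auto simp: mass_nonzero)
  qed
  have "?R \<longleftrightarrow> (\<forall>a\<in>?S. norm (f a + g a) = norm (f a) + norm (g a)) \<and>
      (\<forall>a\<in>?S. norm (f a - g a) = norm (f a) + norm (g a))"
    using defect[of "\<lambda>a. norm (f a + g a)"] defect[of "\<lambda>a. norm (f a - g a)"]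
      zero_iff[of "\<lambda>a. norm (f a + g a)", OF norm_triangle_ineq]
      zero_iff[of "\<lambda>a. norm (f a - g a)", OF norm_triangle_ineq4]
    unfolding Na Nd by argo
  also have "\<dots> \<longleftrightarrow> (\<forall>a\<in>?S. f a = 0 \<or> g a = 0)"
  proof -
    have "norm (f a + g a) = norm (f a) + norm (g a) \<and> norm (f a - g a) = norm (f a) + norm (g a)
        \<longleftrightarrow> f a = 0 \<or> g a = 0" for a
      using norm_add_diff_eq_imp_zero[of "f a" "g a"] by auto
    thus ?thesis by blast
  qed
  also have "\<dots> \<longleftrightarrow> ?L"
    using z by (auto simp: rfibre_def)
  finally show ?thesis by simp
qed

text \<open>On the fibre of \<open>a\<close> such an \<open>f\<close> is the indicator of
  \<open>a\<close>, which makes it the test for single arrows; \<open>U\<close> and \<open>g\<close>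
  are returned for convolving with it.\<close>

lemma bisection_bump:
  obtains f U g where "f \<in> Cc K" "f a = 1" "open U" "inj_on (rng G) U" "open (rng G ` U)"
    "continuous_on (rng G ` U) g" "\<And>x. x \<in> U \<Longrightarrow> g (rng G x) = x" "supp f \<subseteq> U"
    "\<And>b. rng G b = rng G a \<Longrightarrow> b \<noteq> a \<Longrightarrow> f b = 0"
proof -
  obtain U g where U: "open U" "a \<in> U" "inj_on (rng G) U" "open (rng G ` U)"
    "continuous_on (rng G ` U) g" "\<And>x. x \<in> U \<Longrightarrow> g (rng G x) = x"
    using bisection_exists[of a] by blast
  obtain f where f: "f \<in> Cc K" "f a = 1" "\<And>x. x \<notin> U \<Longrightarrow> f x = 0" "supp f \<subseteq> U"
    using Cc_bump[OF U(1,2)] by metis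
  have "f b = 0" if "rng G b = rng G a" "b \<noteq> a" for b
    using U(2,3) f(3) that by (meson inj_onD)
  thus thesis using that f U by blast
qed

text \<open>A formula for \<open>T\<close> on \<open>Cc K\<close> can be applied to a product only
  if the product lies there. With \<open>f\<close> supported in a bisection the sum has at most the
  term \<open>s = g (rng G a)\<close>, which varies continuously with \<open>a\<close>.\<close>

lemma convolution_bisection_Cc:
  assumes f: "f \<in> Cc K" and e: "e \<in> Cc K"
    and U: "open U" "inj_on (rng G) U" "open (rng G ` U)" "continuous_on (rng G ` U) g"
      "\<And>x. x \<in> U \<Longrightarrow> g (rng G x) = x" and fU: "supp f \<subseteq> U"
  shows "convolution G \<mu> f e \<in> Cc K"
proof -
  let ?V = "rng G -` rng G ` U"
  let ?C = "rng G -` rng G ` supp f"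
  \<comment> \<open>The formula is valid and continuous on the open set \<open>?V\<close>; the
    convolution vanishes off the closed set \<open>?C\<close> inside it.\<close>
  let ?F = "\<lambda>a. of_real (mass (g (rng G a))) * (f (g (rng G a)) * e (gmult G (ginv G (g (rng G a))) a))"
  have openV: "open ?V" by (rule open_vimage[OF U(3) continuous_rng])
  have "compact (rng G ` supp f)"
    by (intro compact_continuous_image continuous_rng Cc_compact_supp[OF f])
  hence closedC: "closed ?C"
    by (intro closed_vimage compact_imp_closed continuous_rng)
  have CV: "?C \<subseteq> ?V" using fU by auto
  have inside: "convolution G \<mu> f e a = ?F a" if "a \<in> ?V" for a
  proof -
    obtain s where s: "s \<in> U" "rng G s = rng G a" using \<open>a \<in> ?V\<close> by auto
    have gs: "g (rng G a) = s" using U(5)[OF s(1)] s(2) by simp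
    have "f t = 0" if t: "rng G t = rng G a" "t \<noteq> s" for t
    proof (rule ccontr)
      assume "f t \<noteq> 0"
      hence "t \<in> U" using fU nonzero_in_supp by blast
      hence "t = s" using inj_onD[OF U(2)] s t(1) by simp
      thus False using t(2) by simp
    qed
    thus ?thesis unfolding gs by (intro convolution_single s(2)) simp
  qed
  have outside: "convolution G \<mu> f e a = 0" if "a \<notin> ?C" for a
  proof -
    have "convolution G \<mu> f e a = (\<Sum>s\<in>{}. of_real (mass s) * (f s * e (gmult G (ginv G s) a)))"
    proof (rule convolution_eq)
      fix s assume s: "rng G s = rng G a"
      have "s \<notin> supp f" 
      proof
        assume "s \<in> supp f"
        hence "rng G s \<in> rng G ` supp f" by (rule imageI)
        thus False using that s by simp
      qed
      thus "f s * e (gmult G (ginv G s) a) = 0" by (simp add: zero_off_supp)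
    qed auto
    thus ?thesis by simp
  qed
  have rg: "rng G (g (rng G a)) = rng G a" if "a \<in> ?V" for a
    using that U(5) by auto
  have gr: "continuous_on ?V (\<lambda>a. g (rng G a))"
    by (rule continuous_on_compose2[OF U(4) continuous_rng]) auto
  have mult: "continuous_on ?V (\<lambda>a. gmult G (ginv G (g (rng G a))) a)"
  proof -
    have "continuous_on ?V (\<lambda>a. (\<lambda>(a, b). gmult G a b) (ginv G (g (rng G a)), a))"
    proof (rule continuous_on_compose2[OF continuous_gmult])
      show "continuous_on ?V (\<lambda>a. (ginv G (g (rng G a)), a))"
        by (intro continuous_intros continuous_on_compose2[OF continuous_ginv gr]) auto
      show "(\<lambda>a. (ginv G (g (rng G a)), a)) ` ?V \<subseteq> {(a, b). composable G a b}"
        using rg by (auto simp: composable_def src_ginv)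
    qed
    thus ?thesis by simp
  qed
  have "continuous_on ?V ?F"
    by (intro continuous_intros continuous_on_compose2[OF continuous_mass gr]
        continuous_on_compose2[OF Cc_continuous[OF f] gr]
        continuous_on_compose2[OF Cc_continuous[OF e] mult]) auto
  hence contV: "continuous_on ?V (convolution G \<mu> f e)"
    by (rule continuous_on_eq) (simp add: inside)
  have cont: "continuous_on UNIV (convolution G \<mu> f e)"
    by (rule continuous_on_extend_zero[OF openV contV CV closedC outside])
  \<comment> \<open>Nonzero values occur only at products of composable pairs from the two supports.
    Composability is a closed condition, so these pairs form a compact set.\<close>
  let ?P = "(supp f \<times> supp e) \<inter> {(a, b). composable G a b}"
  have "closed {p. src G (fst p) = rng G (snd p)}"
    by (intro closed_Collect_eq continuous_on_compose2[OF continuous_src[of UNIV]]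
        continuous_on_compose2[OF continuous_rng[of UNIV]] continuous_intros) auto
  moreover have "{p. src G (fst p) = rng G (snd p)} = {(a, b). composable G a b}"
    by (auto simp: composable_def)
  ultimately have "compact ?P"
    by (intro compact_Int_closed compact_Times Cc_compact_supp[OF f] Cc_compact_supp[OF e]) simp
  hence comp: "compact ((\<lambda>(a, b). gmult G a b) ` ?P)"
    by (rule compact_continuous_image[rotated])
      (rule continuous_on_subset[OF continuous_gmult], simp)
  have "a \<in> (\<lambda>(a, b). gmult G a b) ` ?P" if a: "convolution G \<mu> f e a \<noteq> 0" for a
  proof -
    have aV: "a \<in> ?V" using outside[of a] a CV by blast
    let ?s = "g (rng G a)"
    let ?t = "gmult G (ginv G ?s) a"
    have "f ?s \<noteq> 0" "e ?t \<noteq> 0" using inside[OF aV] a by auto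
    hence "?s \<in> supp f" "?t \<in> supp e" by (simp_all add: nonzero_in_supp)
    moreover have "composable G ?s ?t" unfolding composable_def
      using rng_ginv_gmult[OF rg[OF aV]] by simp
    moreover have "a = gmult G ?s ?t" using gmult_ginv_cancel[OF rg[OF aV]] by simp
    ultimately show ?thesis by (intro image_eqI[of _ _ "(?s, ?t)"]) auto
  qed
  hence "supp (convolution G \<mu> f e) \<subseteq> (\<lambda>(a, b). gmult G a b) ` ?P"
    by (rule supp_subset_closed[OF compact_imp_closed[OF comp]])
  hence "compact (supp (convolution G \<mu> f e))"
    by (rule compact_supp_subset[OF comp])
  moreover have "convolution G \<mu> f e a \<in> K" for a
  proof (cases "a \<in> ?V")
    case True
    show ?thesis unfolding inside[OF True]
      by (intro scalars_closed Cc_in[OF f] Cc_in[OF e])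
  next
    case False
    hence "convolution G \<mu> f e a = 0" using outside[of a] CV by blast
    thus ?thesis by simp
  qed
  ultimately show ?thesis using cont by (intro Cc_I) auto
qed

end

section \<open>Diagonal-preserving isometries\<close>

text \<open>
  Multiplicativity is only required when one factor is diagonal, because only then is the
  convolution product evidently in \<open>Cc K\<close>; this makes the hypotheses symmetric under
  passing to the inverse of \<open>T\<close>.
\<close>

locale diag_isometry =
  dom: etale_haar K G \<mu>G + cod: etale_haar K H \<mu>H
  for K :: "complex set"
    and G :: "'g::t2_space groupoid_ops" and \<mu>G :: "'g \<Rightarrow> 'g measure"
    and H :: "'h::t2_space groupoid_ops" and \<mu>H :: "'h \<Rightarrow> 'h measure" +
  fixes T :: "('g \<Rightarrow> complex) \<Rightarrow> ('h \<Rightarrow> complex)"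
  assumes bij_T: "bij_betw T (Cc K) (Cc K)"
    and T_add: "f \<in> Cc K \<Longrightarrow> g \<in> Cc K \<Longrightarrow> T (\<lambda>a. f a + g a) = (\<lambda>h. T f h + T g h)"
    and T_cmult: "c \<in> K \<Longrightarrow> f \<in> Cc K \<Longrightarrow> T (\<lambda>a. c * f a) = (\<lambda>h. c * T f h)"
    and T_diag_left: "d \<in> Cc_diag K G \<Longrightarrow> f \<in> Cc K \<Longrightarrow>
          T (convolution G \<mu>G d f) = convolution H \<mu>H (T d) (T f)"
    and T_diag_right: "d \<in> Cc_diag K G \<Longrightarrow> f \<in> Cc K \<Longrightarrow>
          T (convolution G \<mu>G f d) = convolution H \<mu>H (T f) (T d)"
    and T_diag: "T ` Cc_diag K G = Cc_diag K H"
    and T_isometric: "f \<in> Cc K \<Longrightarrow> Ir_norm H \<mu>H (T f) = Ir_norm G \<mu>G f"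
begin

abbreviation "S \<equiv> inv_into (Cc K) T"

lemma T_Cc: "f \<in> Cc K \<Longrightarrow> T f \<in> Cc K"
  using bij_T by (rule bij_betw_apply)

lemma S_Cc: "g \<in> Cc K \<Longrightarrow> S g \<in> Cc K"
  using bij_betw_apply[OF bij_betw_inv_into[OF bij_T]] .

lemma S_T: "f \<in> Cc K \<Longrightarrow> S (T f) = f"
  using bij_T by (simp add: bij_betw_inv_into_left)

lemma T_S: "g \<in> Cc K \<Longrightarrow> T (S g) = g"
  using bij_T by (simp add: bij_betw_inv_into_right)

lemma T_diff: "f \<in> Cc K \<Longrightarrow> g \<in> Cc K \<Longrightarrow> T (\<lambda>a. f a - g a) = (\<lambda>h. T f h - T g h)"
  using T_add[of f "\<lambda>a. -1 * g a"] T_cmult[of "-1" g] dom.Cc_cmult[of "-1" g] by simp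

lemma T_diag_in: "d \<in> Cc_diag K G \<Longrightarrow> T d \<in> Cc_diag K H"
  using T_diag by blast

lemma S_diag_in:
  assumes "e \<in> Cc_diag K H"
  shows "S e \<in> Cc_diag K G"
proof -
  obtain d where "d \<in> Cc_diag K G" "e = T d" using T_diag assms by blast
  thus ?thesis using S_T[OF dom.Cc_diagD(1)] by simp
qed

lemma S_eqI: "f \<in> Cc K \<Longrightarrow> T f = g \<Longrightarrow> S g = f"
  using S_T by blast

text \<open>Results about \<open>T\<close> become results about its inverse: the second half of the
  fibre isometry, the bijectivity of the arrow map and the continuity of its inverse come from
  here.\<close>

lemma inverse_diag_isometry: "diag_isometry K H \<mu>H G \<mu>G S"
proof unfold_locales
  show "bij_betw S (Cc K) (Cc K)" by (rule bij_betw_inv_into[OF bij_T])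
  fix f g :: "'h \<Rightarrow> complex" assume f: "f \<in> Cc K"
  show "S (\<lambda>a. f a + g a) = (\<lambda>h. S f h + S g h)" if "g \<in> Cc K"
    using f that by (intro S_eqI) (simp_all add: dom.Cc_add S_Cc T_add T_S)
  show "S (\<lambda>a. c * f a) = (\<lambda>h. c * S f h)" if "c \<in> K" for c
    using f that by (intro S_eqI) (simp_all add: dom.Cc_cmult S_Cc T_cmult T_S)
  show "S (convolution H \<mu>H d f) = convolution G \<mu>G (S d) (S f)" if d: "d \<in> Cc_diag K H" for d
    using S_diag_in[OF d] f cod.Cc_diagD(1)[OF d]
    by (intro S_eqI) (simp_all add: dom.convolution_diag_left_Cc S_Cc T_diag_left T_S)
  show "S (convolution H \<mu>H f d) = convolution G \<mu>G (S f) (S d)" if d: "d \<in> Cc_diag K H" for d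
    using S_diag_in[OF d] f cod.Cc_diagD(1)[OF d]
    by (intro S_eqI) (simp_all add: dom.convolution_diag_right_Cc S_Cc T_diag_right T_S)
  show "Ir_norm G \<mu>G (S f) = Ir_norm H \<mu>H f"
    using T_isometric[OF S_Cc[OF f]] by (simp add: T_S f)
next
  have "S ` Cc_diag K H \<subseteq> Cc_diag K G" using S_diag_in by blast
  moreover have "d \<in> S ` Cc_diag K H" if d: "d \<in> Cc_diag K G" for d
    using T_diag_in[OF d] S_T[OF dom.Cc_diagD(1)[OF d]] by (metis image_eqI)
  ultimately show "S ` Cc_diag K H = Cc_diag K G" by blast
qed

section \<open>The map of unit spaces and the isometry between fibres\<close>

definition unit_map :: "'h \<Rightarrow> 'g" where
  "unit_map y = (SOME x. x \<in> units G \<and>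
     (\<forall>d\<in>Cc_diag K G. of_real (cod.mass y) * T d y = of_real (dom.mass x) * d x))"

text \<open>
  The functional \<open>\<omega>\<close> below is a nonzero character of the diagonal subalgebra. If it were not
  a point evaluation, compactness would give finitely many elements of its kernel without
  common zero on the support of some \<open>g\<close> with \<open>\<omega> g = 1\<close>; then \<open>g\<close> would be a multiple of
  the sum of their squared moduli, which is again in the kernel.
\<close>

lemma unit_map_exists:
  assumes y: "y \<in> units H"
  shows "\<exists>x. x \<in> units G \<and>
    (\<forall>d\<in>Cc_diag K G. of_real (cod.mass y) * T d y = of_real (dom.mass x) * d x)"
proof -
  \<comment> \<open>\<open>T d y\<close> alone would be multiplicative only up to
    \<open>cod.mass y\<close>, because diagonal convolution is the pointwise product times the
    mass.\<close>
  define \<omega> where "\<omega> d = of_real (cod.mass y) * T d y" for d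
  have \<omega>_add: "\<omega> (\<lambda>a. d a + e a) = \<omega> d + \<omega> e" if "d \<in> Cc K" "e \<in> Cc K" for d e
    using that by (simp add: \<omega>_def T_add ring_distribs)
  have \<omega>_diff: "\<omega> (\<lambda>a. d a - e a) = \<omega> d - \<omega> e" if "d \<in> Cc K" "e \<in> Cc K" for d e
    using that by (simp add: \<omega>_def T_diff ring_distribs)
  have \<omega>_cmult: "\<omega> (\<lambda>a. c * d a) = c * \<omega> d" if "c \<in> K" "d \<in> Cc K" for c d
    using that by (simp add: \<omega>_def T_cmult)
  have \<omega>_mult: "\<omega> (\<lambda>a. of_real (dom.mass a) * (d a * e a)) = \<omega> d * \<omega> e"
    if d: "d \<in> Cc_diag K G" and e: "e \<in> Cc_diag K G" for d e
  proof -
    have "T (\<lambda>a. of_real (dom.mass a) * (d a * e a)) = convolution H \<mu>H (T d) (T e)"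
      using T_diag_left[OF d dom.Cc_diagD(1)[OF e]] dom.convolution_diag_diag[OF d e] by simp
    also have "\<dots> = (\<lambda>a. of_real (cod.mass a) * (T d a * T e a))"
      by (rule cod.convolution_diag_diag) (use T_diag_in d e in auto)
    finally show ?thesis by (simp add: \<omega>_def)
  qed
  have mass_K: "of_real (1 / cod.mass y) \<in> K" by (rule dom.scalars_closed)
  obtain e where e: "e \<in> Cc_diag K H" "e y = 1"
    using cod.Cc_diag_nonvanishing[OF y] by blast
  define g where "g = (\<lambda>a. of_real (1 / cod.mass y) * S e a)"
  have g: "g \<in> Cc_diag K G"
    unfolding g_def by (intro dom.Cc_diag_cmult S_diag_in e(1) mass_K)
  have \<omega>g: "\<omega> g = 1"
  proof -
    have "\<omega> g = of_real (1 / cod.mass y) * \<omega> (S e)"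
      unfolding g_def by (intro \<omega>_cmult mass_K S_Cc cod.Cc_diagD(1)[OF e(1)])
    also have "\<omega> (S e) = of_real (cod.mass y)"
      by (simp add: \<omega>_def T_S[OF cod.Cc_diagD(1)[OF e(1)]] e(2))
    finally show ?thesis by (simp add: cod.mass_nonzero)
  qed
  have "\<exists>x\<in>units G. \<forall>f\<in>Cc_diag K G. \<omega> f = 0 \<longrightarrow> f x = 0"
  proof (rule ccontr)
    assume "\<not> ?thesis"
    hence "\<forall>x\<in>units G. \<exists>f. f \<in> Cc_diag K G \<and> \<omega> f = 0 \<and> f x \<noteq> 0" by blast
    then obtain F where F: "\<And>x. x \<in> units G \<Longrightarrow> F x \<in> Cc_diag K G"
      "\<And>x. x \<in> units G \<Longrightarrow> \<omega> (F x) = 0" "\<And>x. x \<in> units G \<Longrightarrow> F x x \<noteq> 0"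
      by metis
    have sg: "supp g \<subseteq> units G" using g by (simp add: Cc_diag_def)
    obtain X where X: "X \<subseteq> supp g" "finite X" "supp g \<subseteq> (\<Union>x\<in>X. {a. F x a \<noteq> 0})"
    proof (rule compactE_image[OF Cc_compact_supp[OF dom.Cc_diagD(1)[OF g]],
          of "supp g" "\<lambda>x. {a. F x a \<noteq> 0}"])
      show "open {a. F x a \<noteq> 0}" if "x \<in> supp g" for x
      proof -
        have "F x \<in> Cc_diag K G" using that sg F(1) by blast
        thus ?thesis by (rule continuous_on_nonzero_open[OF Cc_continuous[OF dom.Cc_diagD(1)]])
      qed
    qed (use F(3) sg in blast)+
    have Xu: "x \<in> units G" if "x \<in> X" for x using that X(1) sg by blast
    \<comment> \<open>This is the convolution of the conjugate of \<open>F x\<close> with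
      \<open>F x\<close>, so multiplicativity puts it in the kernel; its values are nonnegative, so
      no cancellation occurs in the sum.\<close>
    let ?q = "\<lambda>x a. of_real (dom.mass a) * (cnj (F x a) * F x a)"
    have q: "?q x \<in> Cc_diag K G \<and> \<omega> (?q x) = 0" if "x \<in> X" for x
    proof -
      note Fx = F[OF Xu[OF that]]
      have c: "(\<lambda>a. cnj (F x a)) \<in> Cc_diag K G"
        unfolding dom.Cc_diag_iff
      proof (intro conjI allI impI)
        show "(\<lambda>a. cnj (F x a)) \<in> Cc K"
          by (rule Cc_dominated[OF dom.Cc_diagD(1)[OF Fx(1)]])
            (use Cc_in[OF dom.Cc_diagD(1)[OF Fx(1)]] in
              \<open>auto intro!: continuous_intros Cc_continuous[OF dom.Cc_diagD(1)[OF Fx(1)]]\<close>)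
      qed (simp add: dom.Cc_diagD(2)[OF Fx(1)])
      have "(\<lambda>a. (of_real (dom.mass a) * cnj (F x a)) * F x a) \<in> Cc_diag K G"
        by (rule dom.Cc_diag_mult_continuous[OF Fx(1)])
          (use Cc_in[OF dom.Cc_diagD(1)[OF c]] in
            \<open>auto intro!: continuous_intros dom.continuous_mass Cc_continuous[OF dom.Cc_diagD(1)[OF Fx(1)]]\<close>)
      thus ?thesis using \<omega>_mult[OF c Fx(1)] Fx(2) by (simp add: mult.assoc)
    qed
    define P where "P = (\<lambda>a. \<Sum>x\<in>X. ?q x a)"
    have "(\<lambda>a. \<Sum>x\<in>Y. ?q x a) \<in> Cc_diag K G \<and> \<omega> (\<lambda>a. \<Sum>x\<in>Y. ?q x a) = 0" if "Y \<subseteq> X" for Y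
      using finite_subset[OF that X(2)] that
    proof (induction Y rule: finite_induct)
      case empty
      have "(\<lambda>a. 0) \<in> Cc_diag K G" by (simp add: dom.Cc_diag_iff dom.Cc_zero)
      moreover have "\<omega> (\<lambda>a. 0) = 0" using \<omega>_diff[OF dom.Cc_zero dom.Cc_zero] by simp
      ultimately show ?case by simp
    next
      case (insert x Y)
      have 1: "?q x \<in> Cc_diag K G" "\<omega> (?q x) = 0" using q insert.prems by auto
      have 2: "(\<lambda>a. \<Sum>x\<in>Y. ?q x a) \<in> Cc_diag K G" "\<omega> (\<lambda>a. \<Sum>x\<in>Y. ?q x a) = 0"
        using insert by auto
      have "(\<lambda>a. \<Sum>x\<in>insert x Y. ?q x a) = (\<lambda>a. ?q x a + (\<Sum>x\<in>Y. ?q x a))"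
        using insert.hyps by simp
      thus ?case
        using dom.Cc_diag_add[OF 1(1) 2(1)] 1(2) 2(2)
          \<omega>_add[OF dom.Cc_diagD(1)[OF 1(1)] dom.Cc_diagD(1)[OF 2(1)]] by simp
    qed
    hence P: "P \<in> Cc_diag K G" "\<omega> P = 0" unfolding P_def by blast+
    note PC = dom.Cc_diagD(1)[OF P(1)] and gC = dom.Cc_diagD(1)[OF g]
    have P_nz: "P a \<noteq> 0" if a: "a \<in> supp g" for a
    proof -
      have "P a = of_real (\<Sum>x\<in>X. dom.mass a * (norm (F x a))\<^sup>2)"
        unfolding P_def of_real_sum of_real_mult of_real_power
        by (intro sum.cong refl arg_cong2[where f = "(*)"])
          (simp only: complex_norm_square[of "F _ a", unfolded of_real_power] mult.commute)
      moreover have "0 < (\<Sum>x\<in>X. dom.mass a * (norm (F x a))\<^sup>2)"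
      proof -
        obtain x where "x \<in> X" "F x a \<noteq> 0" using X(3) a by blast
        thus ?thesis
          by (intro sum_pos2[OF X(2)]) (auto simp: dom.mass_pos dom.mass_nonneg)
      qed
      ultimately show ?thesis by (metis of_real_eq_0_iff less_irrefl)
    qed
    \<comment> \<open>Chosen so that the convolution of \<open>P\<close> with \<open>Q\<close> is
      \<open>g\<close>.\<close>
    define Q where "Q = (\<lambda>a. g a / (of_real (dom.mass a) * P a))"
    have g0: "g a = 0" if "P a = 0" for a
      using P_nz that zero_off_supp[of a g] by blast
    have "continuous_on UNIV Q"
    proof (rule continuous_on_extend_zero[of "{a. P a \<noteq> 0}" _ "supp g"])
      show "continuous_on {a. P a \<noteq> 0} Q" unfolding Q_def
        by (intro continuous_intros continuous_on_subset[OF dom.continuous_mass]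
            continuous_on_subset[OF Cc_continuous[OF PC]] continuous_on_subset[OF Cc_continuous[OF gC]])
          (auto simp: dom.mass_nonzero)
      show "open {a. P a \<noteq> 0}" by (rule continuous_on_nonzero_open[OF Cc_continuous[OF PC]])
      show "supp g \<subseteq> {a. P a \<noteq> 0}" using P_nz by blast
      show "closed (supp g)" by (simp add: supp_def)
      show "Q a = 0" if "a \<notin> supp g" for a using zero_off_supp[OF that] by (simp add: Q_def)
    qed
    hence "Q \<in> Cc K"
      by (rule Cc_dominated[OF gC]) (use Cc_in[OF gC] Cc_in[OF PC] in \<open>auto simp: Q_def\<close>)
    hence Q: "Q \<in> Cc_diag K G"
      using dom.Cc_diagD(2)[OF g] by (auto simp: dom.Cc_diag_iff Q_def)
    have "(\<lambda>a. of_real (dom.mass a) * (P a * Q a)) = g"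
      by (rule ext) (use g0 in \<open>auto simp: Q_def dom.mass_nonzero\<close>)
    hence "\<omega> g = 0" using \<omega>_mult[OF P(1) Q] P(2) by simp
    thus False using \<omega>g by simp
  qed
  then obtain x where x: "x \<in> units G" and ker: "\<And>f. f \<in> Cc_diag K G \<Longrightarrow> \<omega> f = 0 \<Longrightarrow> f x = 0"
    by blast
  have \<omega>_K: "\<omega> f \<in> K" if "f \<in> Cc K" for f
    unfolding \<omega>_def by (intro dom.scalars_closed Cc_in[OF T_Cc[OF that]])
  have eval: "f x = \<omega> f * g x" if f: "f \<in> Cc_diag K G" for f
  proof -
    note fC = dom.Cc_diagD(1)[OF f] and gC = dom.Cc_diagD(1)[OF g]
    \<comment> \<open>Subtracting \<open>\<omega> f\<close> times \<open>g\<close> from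
      \<open>f\<close> lands in the kernel since \<open>\<omega> g = 1\<close>; hence evaluation at
      \<open>x\<close> is a multiple of \<open>\<omega>\<close>.\<close>
    have m: "(\<lambda>a. - \<omega> f * g a) \<in> Cc_diag K G"
      by (intro dom.Cc_diag_cmult g) (simp add: \<omega>_K[OF fC])
    have "(\<lambda>a. f a + - \<omega> f * g a) \<in> Cc_diag K G" by (rule dom.Cc_diag_add[OF f m])
    moreover have "\<omega> (\<lambda>a. f a + - \<omega> f * g a) = 0"
      using \<omega>_add[OF fC dom.Cc_diagD(1)[OF m]] \<omega>_cmult[of "- \<omega> f" g] \<omega>_K[OF fC] gC \<omega>g by simp
    ultimately have "f x + - \<omega> f * g x = 0" by (rule ker)
    thus ?thesis by simp
  qed
  have gx: "g x \<noteq> 0"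
  proof
    assume "g x = 0"
    moreover obtain d where "d \<in> Cc_diag K G" "d x = 1" using dom.Cc_diag_nonvanishing[OF x] by blast
    ultimately show False using eval by force
  qed
  \<comment> \<open>Applying \<open>eval\<close> to the convolution square of \<open>g\<close>
    identifies the factor \<open>g x\<close> as \<open>1 / dom.mass x\<close>.\<close>
  have "(\<lambda>a. (of_real (dom.mass a) * g a) * g a) \<in> Cc_diag K G"
    by (intro dom.Cc_diag_mult_continuous[OF g] continuous_intros dom.continuous_mass
        Cc_continuous[OF dom.Cc_diagD(1)[OF g]] dom.scalars_closed Cc_in[OF dom.Cc_diagD(1)[OF g]])
  from eval[OF this] have "of_real (dom.mass x) * (g x * g x) = \<omega> g * \<omega> g * g x"
    using \<omega>_mult[OF g g] by (simp add: mult.assoc)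
  hence "of_real (dom.mass x) * g x = 1" using gx by (simp add: \<omega>g)
  hence "\<omega> f = of_real (dom.mass x) * f x" if "f \<in> Cc_diag K G" for f
    using eval[OF that] by (metis mult.assoc mult.commute mult_1)
  thus ?thesis using x by (auto simp: \<omega>_def)
qed

lemma unit_map:
  assumes "y \<in> units H"
  shows unit_map_in_units: "unit_map y \<in> units G"
    and T_diag_unit_map: "d \<in> Cc_diag K G \<Longrightarrow>
      of_real (cod.mass y) * T d y = of_real (dom.mass (unit_map y)) * d (unit_map y)"
  using someI_ex[OF unit_map_exists[OF assms]] unfolding unit_map_def by blast+

lemma inj_unit_map: "inj_on unit_map (units H)"
proof (rule inj_onI, rule ccontr)
  fix y z assume y: "y \<in> units H" and z: "z \<in> units H" and eq: "unit_map y = unit_map z" and "y \<noteq> z"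
  obtain e where e: "e \<in> Cc_diag K H" "e y = 1" "e z = 0"
    using cod.diag_separates[OF y \<open>y \<noteq> z\<close>] by blast
  have "of_real (cod.mass y) * T (S e) y = of_real (cod.mass z) * T (S e) z"
    using T_diag_unit_map[OF y S_diag_in[OF e(1)]] T_diag_unit_map[OF z S_diag_in[OF e(1)]] eq by simp
  thus False using e T_S[OF cod.Cc_diagD(1)[OF e(1)]] by (simp add: cod.mass_nonzero)
qed

lemma inverse_unit_map:
  assumes y: "y \<in> units H"
  shows "diag_isometry.unit_map K H \<mu>H G \<mu>G S (unit_map y) = y"
proof (rule ccontr)
  interpret inv: diag_isometry K H \<mu>H G \<mu>G S by (rule inverse_diag_isometry)
  let ?z = "inv.unit_map (unit_map y)"
  assume "?z \<noteq> y"
  moreover have "?z \<in> units H" by (intro inv.unit_map_in_units unit_map_in_units y)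
  ultimately obtain e where e: "e \<in> Cc_diag K H" "e y = 1" "e ?z = 0"
    using cod.diag_separates[OF y] by metis
  have "of_real (cod.mass y) * T (S e) y = of_real (dom.mass (unit_map y)) * S e (unit_map y)"
    by (rule T_diag_unit_map[OF y S_diag_in[OF e(1)]])
  also have "\<dots> = of_real (cod.mass ?z) * e ?z"
    by (rule inv.T_diag_unit_map[OF unit_map_in_units[OF y] e(1)])
  finally show False using e T_S[OF cod.Cc_diagD(1)[OF e(1)]] by (simp add: cod.mass_nonzero)
qed

text \<open>A diagonal bump equal to 1 at \<open>unit_map y\<close>, and zero where the fibre norm
  of \<open>f\<close> exceeds its value there by \<open>\<epsilon>\<close> or more, pushes the
  global norm below that bound. Multiplying \<open>f\<close> by it does not change
  \<open>T f\<close> over \<open>y\<close>, and \<open>T\<close> preserves the global norm.\<close>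

lemma fibre_norm_T_le:
  assumes f: "f \<in> Cc K" and y: "y \<in> units H"
  shows "cod.fibre_norm (T f) y \<le> dom.fibre_norm f (unit_map y)"
proof (rule field_le_epsilon)
  fix \<epsilon> :: real assume \<epsilon>: "0 < \<epsilon>"
  let ?x = "unit_map y"
  let ?B = "dom.fibre_norm f ?x + \<epsilon>"
  note x = unit_map_in_units[OF y]
  have "openin (top_of_set (units G)) (units G \<inter> dom.fibre_norm f -` {..<?B})"
    using dom.fibre_norm_continuous[OF f] by (rule continuous_openin_preimage_gen) simp
  hence op: "open (units G \<inter> dom.fibre_norm f -` {..<?B})"
    using dom.open_units openin_open_eq by blast
  obtain d where d: "d \<in> Cc_diag K G" "d ?x = 1"
      "\<And>z. z \<notin> units G \<inter> dom.fibre_norm f -` {..<?B} \<Longrightarrow> d z = 0" "\<And>z. norm (d z) \<le> 1"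
    by (rule dom.diag_bump[OF op _ x]) (use \<epsilon> x in auto)
  \<comment> \<open>Division by the mass makes convolution with \<open>d'\<close> multiplication by
    the value of \<open>d\<close> at the range.\<close>
  define d' where "d' = (\<lambda>a. of_real (1 / dom.mass a) * d a)"
  have d': "d' \<in> Cc_diag K G" unfolding d'_def
    by (rule dom.Cc_diag_mult_continuous[OF d(1)])
      (use dom.mass_nonzero in \<open>auto intro!: continuous_intros dom.continuous_mass simp del: of_real_divide\<close>)
  let ?df = "convolution G \<mu>G d' f"
  have df: "?df a = d (rng G a) * f a" for a
    unfolding dom.convolution_diag_left[OF d'] by (simp add: d'_def dom.mass_nonzero)
  have dfC: "?df \<in> Cc K" by (rule dom.convolution_diag_left_Cc[OF d' f])
  have "dom.fibre_norm ?df z \<le> ?B" if z: "z \<in> units G" for z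
  proof -
    have "dom.fibre_norm ?df z = norm (d z) * dom.fibre_norm f z"
      by (rule dom.fibre_norm_mult_rng[OF f _ dfC z]) (simp add: df)
    also have "\<dots> \<le> ?B"
    proof (cases "dom.fibre_norm f z < ?B")
      case True
      have "norm (d z) * dom.fibre_norm f z \<le> 1 * dom.fibre_norm f z"
        by (intro mult_right_mono d(4) dom.fibre_norm_nonneg)
      thus ?thesis using True by simp
    next
      case False
      hence "d z = 0" by (intro d(3)) simp
      thus ?thesis using \<epsilon> dom.fibre_norm_nonneg[of f ?x] by simp
    qed
    finally show ?thesis .
  qed
  hence bound: "Ir_norm G \<mu>G ?df \<le> ?B" by (rule dom.Ir_norm_le)
  have Tdf: "T ?df h = 1 * T f h" if h: "rng H h = y" for h
  proof -
    have "T ?df h = of_real (cod.mass y) * (T d' y * T f h)"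
      using T_diag_left[OF d' f] cod.convolution_diag_left[OF T_diag_in[OF d']] h by simp
    also have "\<dots> = (of_real (dom.mass ?x) * d' ?x) * T f h"
      by (simp only: T_diag_unit_map[OF y d', symmetric] mult.assoc)
    also have "\<dots> = T f h" by (simp add: d'_def d(2) dom.mass_nonzero)
    finally show ?thesis by simp
  qed
  have "cod.fibre_norm (T ?df) y = norm (1::complex) * cod.fibre_norm (T f) y"
    by (rule cod.fibre_norm_mult_rng[OF T_Cc[OF f] Tdf T_Cc[OF dfC] y])
  hence "cod.fibre_norm (T f) y = cod.fibre_norm (T ?df) y" by simp
  also have "\<dots> \<le> Ir_norm H \<mu>H (T ?df)"
    by (rule cod.fibre_norm_le_Ir_norm[OF T_Cc[OF dfC] y])
  also have "\<dots> \<le> ?B" using bound by (simp add: T_isometric[OF dfC])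
  finally show "cod.fibre_norm (T f) y \<le> ?B" .
qed

lemma fibre_norm_T:
  assumes f: "f \<in> Cc K" and y: "y \<in> units H"
  shows "cod.fibre_norm (T f) y = dom.fibre_norm f (unit_map y)"
proof (rule antisym[OF fibre_norm_T_le[OF f y]])
  interpret inv: diag_isometry K H \<mu>H G \<mu>G S by (rule inverse_diag_isometry)
  show "dom.fibre_norm f (unit_map y) \<le> cod.fibre_norm (T f) y"
    using inv.fibre_norm_T_le[OF T_Cc[OF f] unit_map_in_units[OF y]]
    by (simp add: S_T[OF f] inverse_unit_map[OF y])
qed

section \<open>The weighted bijection of arrows\<close>

lemma T_disjoint_iff:
  assumes f: "f \<in> Cc K" and g: "g \<in> Cc K" and y: "y \<in> units H"
  shows "(\<forall>h. rng H h = y \<longrightarrow> T f h = 0 \<or> T g h = 0) \<longleftrightarrow>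
    (\<forall>a. rng G a = unit_map y \<longrightarrow> f a = 0 \<or> g a = 0)"
  unfolding cod.fibre_disjoint_iff[OF T_Cc[OF f] T_Cc[OF g] y]
    dom.fibre_disjoint_iff[OF f g unit_map_in_units[OF y]]
  using fibre_norm_T[OF f y] fibre_norm_T[OF g y]
    fibre_norm_T[OF dom.Cc_add[OF f g] y] fibre_norm_T[OF dom.Cc_diff[OF f g] y]
  by (simp add: T_add[OF f g] T_diff[OF f g])

text \<open>The functional taking \<open>f\<close> to \<open>T f h\<close> is a multiple of
  evaluation at \<open>a\<close> once it kills every \<open>f\<close> with \<open>f a = 0\<close>.
  On the fibre such an \<open>f\<close> is disjoint from a bump \<open>b\<close> at
  \<open>a\<close>, so \<open>T f\<close> and \<open>T b\<close> are disjoint over the range of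
  \<open>h\<close>, and \<open>T b h\<close> is nonzero.\<close>

lemma arrow_map_exists:
  "\<exists>a. rng G a = unit_map (rng H h) \<and> (\<exists>c. norm c * cod.mass h = dom.mass a \<and> (\<forall>f\<in>Cc K. T f h = c * f a))"
proof -
  let ?y = "rng H h"
  let ?x = "unit_map ?y"
  have y: "?y \<in> units H" by simp
  note x = unit_map_in_units[OF y]
  obtain e where e: "e \<in> Cc K" "e h = 1" "\<And>k. rng H k = ?y \<Longrightarrow> k \<noteq> h \<Longrightarrow> e k = 0"
    using cod.bisection_bump[of h] by metis
  have Ne: "cod.fibre_norm e ?y = cod.mass h"
    using cod.fibre_norm_eq[of ?y "{h}" e] e by (auto simp: rfibre_def)
  note SeC = S_Cc[OF e(1)]
  have NSe: "dom.fibre_norm (S e) ?x = cod.mass h"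
    using fibre_norm_T[OF SeC y] Ne by (simp add: T_S[OF e(1)])
  \<comment> \<open>Any arrow where the preimage of a bump at \<open>h\<close> is nonzero will do;
    there is one because the fibre norm is preserved and positive.\<close>
  have "\<exists>a. rng G a = ?x \<and> S e a \<noteq> 0"
  proof (rule ccontr)
    assume "\<not> ?thesis"
    hence "dom.fibre_norm (S e) ?x = (\<Sum>a\<in>{}. dom.mass a * norm (S e a))"
      by (intro dom.fibre_norm_eq x SeC) (auto simp: rfibre_def)
    thus False using NSe cod.mass_pos[of h] by simp
  qed
  then obtain a where a: "rng G a = ?x" "S e a \<noteq> 0" by blast
  obtain b where b: "b \<in> Cc K" "b a = 1" "\<And>k. rng G k = ?x \<Longrightarrow> k \<noteq> a \<Longrightarrow> b k = 0"
    using dom.bisection_bump[of a] a(1) by metis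
  \<comment> \<open>On its fibre \<open>e = T (S e)\<close> is nonzero only at \<open>h\<close>. If
    \<open>T b\<close> vanished there, \<open>b\<close> and \<open>S e\<close> would be disjoint,
    but both are nonzero at \<open>a\<close>.\<close>
  have Tb: "T b h \<noteq> 0"
  proof
    assume "T b h = 0"
    hence "\<forall>k. rng H k = ?y \<longrightarrow> T b k = 0 \<or> T (S e) k = 0"
      using e(3) T_S[OF e(1)] by metis
    hence "b a = 0 \<or> S e a = 0" using T_disjoint_iff[OF b(1) SeC y] a(1) by blast
    thus False using a b by simp
  qed
  have vanish: "T f h = 0" if f: "f \<in> Cc K" "f a = 0" for f
  proof -
    have "\<forall>k. rng G k = ?x \<longrightarrow> f k = 0 \<or> b k = 0" using f(2) b(3) by metis
    hence "T f h = 0 \<or> T b h = 0" using T_disjoint_iff[OF f(1) b(1) y] by blast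
    thus ?thesis using Tb by simp
  qed
  have formula: "T f h = T b h * f a" if f: "f \<in> Cc K" for f
  proof -
    have m: "(\<lambda>k. f a * b k) \<in> Cc K" by (rule dom.Cc_cmult[OF Cc_in[OF f] b(1)])
    have "T (\<lambda>k. f k - f a * b k) h = 0"
      by (rule vanish[OF dom.Cc_diff[OF f m]]) (simp add: b(2))
    thus ?thesis by (simp add: T_diff[OF f m] T_cmult[OF Cc_in[OF f] b(1)])
  qed
  have Nb: "dom.fibre_norm b ?x = dom.mass a"
    using dom.fibre_norm_eq[of ?x "{a}" b] a b x by (auto simp: rfibre_def)
  have "norm (T b h) * cod.mass h \<le> dom.mass a"
    using cod.fibre_norm_ge[OF T_Cc[OF b(1)], of h] fibre_norm_T[OF b(1) y] Nb
    by (simp add: mult.commute)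
  \<comment> \<open>The lower bound on the factor uses \<open>S e\<close> instead of
    \<open>b\<close>: the factor times \<open>S e a\<close> is 1, while \<open>S e\<close>
    contributes at most \<open>cod.mass h\<close> at \<open>a\<close>.\<close>
  moreover have "dom.mass a \<le> norm (T b h) * cod.mass h"
  proof -
    have "1 = norm (T b h * S e a)" using formula[OF SeC] T_S[OF e(1)] e(2) by simp
    hence "dom.mass a = norm (T b h) * (dom.mass a * norm (S e a))"
      by (simp add: norm_mult algebra_simps)
    also have "\<dots> \<le> norm (T b h) * cod.mass h"
      using dom.fibre_norm_ge[OF SeC, of a] NSe a(1) by (intro mult_left_mono) auto
    finally show ?thesis .
  qed
  ultimately have "norm (T b h) * cod.mass h = dom.mass a" by simp
  thus ?thesis using a(1) formula by blast
qed

end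

context diag_isometry
begin

definition arrow_map :: "'h \<Rightarrow> 'g" where
  "arrow_map h = (SOME a. rng G a = unit_map (rng H h) \<and>
     (\<exists>c. norm c * cod.mass h = dom.mass a \<and> (\<forall>f\<in>Cc K. T f h = c * f a)))"

definition coeff :: "'h \<Rightarrow> complex" where
  "coeff h = (SOME c. norm c * cod.mass h = dom.mass (arrow_map h) \<and>
     (\<forall>f\<in>Cc K. T f h = c * f (arrow_map h)))"

lemma rng_arrow_map: "rng G (arrow_map h) = unit_map (rng H h)"
  and coeff_exists: "\<exists>c. norm c * cod.mass h = dom.mass (arrow_map h) \<and>
      (\<forall>f\<in>Cc K. T f h = c * f (arrow_map h))"
  using someI_ex[OF arrow_map_exists[of h]] unfolding arrow_map_def by blast+

lemma norm_coeff: "norm (coeff h) * cod.mass h = dom.mass (arrow_map h)"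
  and T_eq: "f \<in> Cc K \<Longrightarrow> T f h = coeff h * f (arrow_map h)"
  using someI_ex[OF coeff_exists[of h]] unfolding coeff_def by blast+

lemma coeff_nonzero: "coeff h \<noteq> 0"
  using norm_coeff[of h] dom.mass_pos[of "arrow_map h"] by auto

text \<open>\<open>Cc K\<close> separates points and the coefficient is nonzero, so the evaluation
  point is determined. Both inverse laws and the uniqueness of the isomorphism rest on this.\<close>

lemma arrow_map_unique:
  assumes "\<And>f. f \<in> Cc K \<Longrightarrow> T f h = c * f a"
  shows "arrow_map h = a"
proof (rule ccontr)
  assume "arrow_map h \<noteq> a"
  then obtain f where f: "f \<in> Cc K" "f (arrow_map h) = 1" "f a = 0"
    using dom.Cc_separates by blast
  thus False using assms[OF f(1)] T_eq[OF f(1), of h] coeff_nonzero by simp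
qed

lemma arrow_map_inverse:
  "arrow_map (diag_isometry.arrow_map K H \<mu>H G \<mu>G S a) = a"
proof -
  interpret inv: diag_isometry K H \<mu>H G \<mu>G S by (rule inverse_diag_isometry)
  show ?thesis
  proof (rule arrow_map_unique)
    fix f :: "'g \<Rightarrow> complex" assume f: "f \<in> Cc K"
    have "f a = inv.coeff a * T f (inv.arrow_map a)"
      using inv.T_eq[OF T_Cc[OF f], of a] by (simp add: S_T[OF f])
    thus "T f (inv.arrow_map a) = (1 / inv.coeff a) * f a"
      using inv.coeff_nonzero[of a] by simp
  qed
qed

lemma inverse_arrow_map:
  "diag_isometry.arrow_map K H \<mu>H G \<mu>G S (arrow_map h) = h"
proof -
  interpret inv: diag_isometry K H \<mu>H G \<mu>G S by (rule inverse_diag_isometry)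
  show ?thesis
  proof (rule inv.arrow_map_unique)
    fix g :: "'h \<Rightarrow> complex" assume g: "g \<in> Cc K"
    have "g h = coeff h * S g (arrow_map h)"
      using T_eq[OF S_Cc[OF g], of h] by (simp add: T_S[OF g])
    thus "S g (arrow_map h) = (1 / coeff h) * g h"
      using coeff_nonzero[of h] by simp
  qed
qed

lemma bij_arrow_map: "bij arrow_map"
  using inverse_arrow_map arrow_map_inverse by (intro o_bij[of "diag_isometry.arrow_map K H \<mu>H G \<mu>G S"]) auto

lemma inv_arrow_map: "inv arrow_map = diag_isometry.arrow_map K H \<mu>H G \<mu>G S"
  using inverse_arrow_map arrow_map_inverse by (intro inv_unique_comp) auto

text \<open>Right convolution with a diagonal function reads its value at the source. If the sources
  did not match, a \<open>d\<close> equal to 1 at one unit and 0 at the other would contradict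
  multiplicativity.\<close>

lemma src_arrow_map: "src G (arrow_map h) = unit_map (src H h)"
proof (rule ccontr)
  let ?u = "src G (arrow_map h)" and ?v = "unit_map (src H h)"
  assume "?u \<noteq> ?v"
  then obtain d where d: "d \<in> Cc_diag K G" "d ?u = 1" "d ?v = 0"
    using dom.diag_separates[of ?u ?v] by auto
  obtain f where f: "f \<in> Cc K" "f (arrow_map h) = 1"
    using dom.Cc_nonvanishing[of "arrow_map h"] by blast
  have "coeff h * of_real (dom.mass ?u) = coeff h * convolution G \<mu>G f d (arrow_map h)"
    by (simp add: dom.convolution_diag_right[OF d(1)] d f)
  also have "\<dots> = convolution H \<mu>H (T f) (T d) h"
    using T_eq[OF dom.convolution_diag_right_Cc[OF d(1) f(1)], of h] T_diag_right[OF d(1) f(1)] by simp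
  also have "\<dots> = T f h * (of_real (cod.mass (src H h)) * T d (src H h))"
    by (simp add: cod.convolution_diag_right[OF T_diag_in[OF d(1)]])
  also have "\<dots> = 0" using T_diag_unit_map[OF cod.src_in_units d(1), of h] d(3) by simp
  finally show False using coeff_nonzero dom.mass_nonzero by simp
qed

text \<open>A diagonal function nonzero at \<open>y\<close> has a diagonal preimage under
  \<open>T\<close>, nonzero at \<open>arrow_map y\<close>. So this arrow is a unit and equals its
  range.\<close>

lemma arrow_map_unit:
  assumes "y \<in> units H"
  shows "arrow_map y = unit_map y"
proof -
  obtain e where e: "e \<in> Cc_diag K H" "e y = 1"
    using cod.Cc_diag_nonvanishing[OF assms] by blast
  have "e y = coeff y * S e (arrow_map y)"
    using T_eq[OF S_Cc[OF cod.Cc_diagD(1)[OF e(1)]], of y] T_S[OF cod.Cc_diagD(1)[OF e(1)]] by simp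
  hence "arrow_map y \<in> units G"
    using e(2) dom.Cc_diagD(2)[OF S_diag_in[OF e(1)]] by fastforce
  thus ?thesis using rng_arrow_map[of y] assms by (simp add: dom.rng_unit cod.rng_unit)
qed

text \<open>Coefficients never vanish, so \<open>T f\<close> is nonzero exactly where
  \<open>f\<close> composed with \<open>arrow_map\<close> is. Bumps \<open>f\<close> thus give open
  neighbourhoods mapped into a prescribed open set.\<close>

lemma continuous_arrow_map: "continuous_on UNIV arrow_map"
proof (rule continuous_at_imp_continuous_on, rule ballI)
  fix h
  show "isCont arrow_map h"
    unfolding continuous_at_open
  proof (intro allI impI, elim conjE)
    fix U assume U: "open U" "arrow_map h \<in> U"
    obtain f where f: "f \<in> Cc K" "f (arrow_map h) = 1" "\<And>x. x \<notin> U \<Longrightarrow> f x = 0"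
      using dom.Cc_bump[OF U] by metis
    have "open {k. T f k \<noteq> 0}"
      by (rule continuous_on_nonzero_open[OF Cc_continuous[OF T_Cc[OF f(1)]]])
    moreover have "h \<in> {k. T f k \<noteq> 0}" using T_eq[OF f(1)] f(2) coeff_nonzero by simp
    moreover have "\<forall>k\<in>{k. T f k \<noteq> 0}. arrow_map k \<in> U"
      using T_eq[OF f(1)] f(3) by (metis mem_Collect_eq mult_zero_right)
    ultimately show "\<exists>V. open V \<and> h \<in> V \<and> (\<forall>k\<in>V. arrow_map k \<in> U)" by blast
  qed
qed

lemma continuous_coeff: "continuous_on UNIV coeff"
proof (rule continuous_at_imp_continuous_on, rule ballI)
  fix h
  obtain f where f: "f \<in> Cc K" "f (arrow_map h) = 1"
    using dom.Cc_nonvanishing[of "arrow_map h"] by blast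
  let ?V = "{k. T f k \<noteq> 0}"
  have V: "open ?V" by (rule continuous_on_nonzero_open[OF Cc_continuous[OF T_Cc[OF f(1)]]])
  have "continuous_on ?V (\<lambda>k. T f k / f (arrow_map k))"
    by (intro continuous_intros continuous_on_subset[OF Cc_continuous[OF T_Cc[OF f(1)]]]
        continuous_on_compose2[OF Cc_continuous[OF f(1)]] continuous_on_subset[OF continuous_arrow_map])
      (auto simp: T_eq[OF f(1)])
  hence "continuous_on ?V coeff"
    by (rule continuous_on_eq) (auto simp: T_eq[OF f(1)])
  moreover have "h \<in> ?V" using T_eq[OF f(1)] f(2) coeff_nonzero by simp
  ultimately show "isCont coeff h" using continuous_on_eq_continuous_at[OF V, of coeff] by blast
qed

section \<open>Phase and density\<close>

definition phase :: "'h \<Rightarrow> complex" where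
  "phase h = coeff h * of_real (cod.mass h) / of_real (dom.mass (arrow_map h))"

text \<open>The Radon-Nikodym derivative of measures made of point masses is the quotient of the
  masses. By \<open>norm_coeff\<close> it is the modulus of the coefficient, which leaves
  \<open>phase\<close> as the unimodular factor.\<close>

definition density_ratio :: "'g \<Rightarrow> real" where
  "density_ratio a = dom.mass a / cod.mass (inv arrow_map a)"

lemma norm_phase: "norm (phase h) = 1"
  using norm_coeff[of h] cod.mass_nonneg[of h] dom.mass_pos[of "arrow_map h"]
  by (simp add: phase_def norm_divide norm_mult)

lemma continuous_phase: "continuous_on UNIV phase"
  unfolding phase_def[abs_def]
  by (intro continuous_intros continuous_coeff cod.continuous_mass
      continuous_on_compose2[OF dom.continuous_mass continuous_arrow_map])
    (auto simp: dom.mass_nonzero)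

lemma T_eq_phase_density:
  assumes "f \<in> Cc K"
  shows "T f h = phase h * of_real (density_ratio (arrow_map h)) * f (arrow_map h)"
proof -
  have "phase h * of_real (density_ratio (arrow_map h)) = coeff h"
    using dom.mass_nonzero[of "arrow_map h"] cod.mass_nonzero[of h]
    by (simp add: phase_def density_ratio_def inv_arrow_map inverse_arrow_map)
  thus ?thesis using T_eq[OF assms] by simp
qed

lemma continuous_inv_arrow_map: "continuous_on UNIV (inv arrow_map)"
  unfolding inv_arrow_map
  by (rule diag_isometry.continuous_arrow_map[OF inverse_diag_isometry])

lemma density_ratio_RN: "continuous_RN_derivative G \<mu>G \<mu>H arrow_map density_ratio"
proof -
  interpret inv: diag_isometry K H \<mu>H G \<mu>G S by (rule inverse_diag_isometry)
  have cont: "continuous_on UNIV density_ratio"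
    unfolding density_ratio_def[abs_def]
    by (intro continuous_intros dom.continuous_mass
        continuous_on_compose2[OF cod.continuous_mass continuous_inv_arrow_map])
      (auto simp: cod.mass_nonzero)
  have nonneg: "0 \<le> density_ratio a" for a
    by (simp add: density_ratio_def dom.mass_nonneg cod.mass_nonneg)
  have "emeasure (\<mu>G x) E =
      (\<integral>\<^sup>+ a \<in> E. ennreal (density_ratio a) \<partial>(distr (\<mu>H (inv arrow_map x)) borel arrow_map))"
    if x: "x \<in> units G" and E: "E \<in> sets borel" "E \<subseteq> rfibre G x" for x E
  proof -
    let ?y = "inv arrow_map x"
    let ?M = "distr (\<mu>H ?y) borel arrow_map"
    let ?N = "density ?M (\<lambda>a. ennreal (density_ratio a))"
    \<comment> \<open>The inverse takes units to units, so \<open>\<mu>H ?y\<close> belongs to the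
      Haar system and is carried by the fibre corresponding to that of \<open>x\<close>.\<close>
    have y_eq: "?y = inv.unit_map x" by (simp add: inv_arrow_map inv.arrow_map_unit x)
    have y: "?y \<in> units H" unfolding y_eq by (rule inv.unit_map_in_units[OF x])
    have meas: "(\<lambda>a. ennreal (density_ratio a)) \<in> borel_measurable ?M"
      using borel_measurable_continuous_onI[OF cont] by simp
    have meas_map: "arrow_map \<in> measurable (\<mu>H ?y) borel"
      using borel_measurable_continuous_onI[OF continuous_arrow_map]
        measurable_cong_sets[OF cod.sets_haar[OF y] refl] by blast
    have point: "emeasure (\<mu>G x) {a} = emeasure ?N {a}" if a: "a \<in> E" for a
    proof -
      have ra: "rng G a = x" using a E(2) by (auto simp: rfibre_def)
      have pre: "arrow_map -` {a} \<inter> space (\<mu>H ?y) = {inv arrow_map a}"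
        using bij_arrow_map by (auto simp: cod.space_haar[OF y] bij_is_inj bij_is_surj surj_f_inv_f)
      have ry: "rng H (inv arrow_map a) = ?y"
        using inv.rng_arrow_map[of a] unfolding y_eq by (simp add: ra inv_arrow_map)
      have "emeasure ?N {a} = (\<integral>\<^sup>+ b. ennreal (density_ratio b) * indicator {a} b \<partial>?M)"
        by (rule emeasure_density[OF meas]) simp
      also have "\<dots> = ennreal (density_ratio a) * emeasure ?M {a}"
        by (subst nn_integral_indicator_singleton) (auto intro: measurable_cong)
      also have "emeasure ?M {a} = emeasure (\<mu>H ?y) {inv arrow_map a}"
        by (subst emeasure_distr[OF meas_map]) (auto simp: pre)
      also have "\<dots> = ennreal (cod.mass (inv arrow_map a))"
        using cod.emeasure_singleton[of "inv arrow_map a"] by (simp add: ry)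
      also have "ennreal (density_ratio a) * ennreal (cod.mass (inv arrow_map a))
          = ennreal (density_ratio a * cod.mass (inv arrow_map a))"
        by (rule ennreal_mult[symmetric]) (use nonneg cod.mass_nonneg in auto)
      also have "density_ratio a * cod.mass (inv arrow_map a) = dom.mass a"
        by (simp add: density_ratio_def cod.mass_nonzero)
      also have "ennreal (dom.mass a) = emeasure (\<mu>G x) {a}"
        using dom.emeasure_singleton[of a] by (simp add: ra)
      finally show ?thesis by simp
    qed
    have "emeasure (\<mu>G x) E = emeasure ?N E"
    proof (rule measure_eq_of_singletons[OF _ _ _ point])
      show "sets (\<mu>G x) = sets ?N" by (simp add: dom.sets_haar[OF x])
      show "E \<in> sets (\<mu>G x)" using E by (simp add: dom.sets_haar[OF x])
      show "F \<in> sets (\<mu>G x)" if "F \<subseteq> E" "countable F" for F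
        unfolding dom.sets_haar[OF x] by (rule sets.countable[OF _ that(2)]) simp
      show "0 < emeasure (\<mu>G x) {a}" if "a \<in> E" for a
        using dom.emeasure_singleton[of a] dom.mass_pos[of a] that E(2) by (auto simp: rfibre_def)
    qed
    also have "\<dots> = (\<integral>\<^sup>+ a. ennreal (density_ratio a) * indicator E a \<partial>?M)"
      by (rule emeasure_density[OF meas]) (simp add: E)
    finally show ?thesis .
  qed
  thus ?thesis unfolding continuous_RN_derivative_def using cont nonneg by blast
qed

end

section \<open>Multiplicativity: the groupoid morphism and the cocycle\<close>

locale diag_algebra_isometry = diag_isometry +
  assumes T_mult: "f \<in> Cc K \<Longrightarrow> g \<in> Cc K \<Longrightarrow>
      T (convolution G \<mu>G f g) = convolution H \<mu>H (T f) (T g)"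
begin

text \<open>For bumps \<open>f\<close> at \<open>?a\<close> and \<open>e\<close> at
  \<open>?b\<close>, the convolution on \<open>H\<close> at the product and the one on
  \<open>G\<close> at \<open>?c\<close> each have one term. The former is nonzero, so
  \<open>e\<close> is nonzero at \<open>gmult G (ginv G ?a) ?c\<close>; this arrow has the range of
  \<open>?b\<close>, so it is \<open>?b\<close>. Comparing the two terms gives the
  coefficients.\<close>

lemma arrow_map_gmult_coeff:
  assumes comp: "composable H h k"
  shows "arrow_map (gmult H h k) = gmult G (arrow_map h) (arrow_map k)"
    and "coeff (gmult H h k) * of_real (dom.mass (arrow_map h)) = of_real (cod.mass h) * coeff h * coeff k"
proof -
  let ?a = "arrow_map h" and ?b = "arrow_map k" and ?c = "arrow_map (gmult H h k)"
  have hk: "src H h = rng H k" using comp by (simp add: composable_def)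
  have ab: "src G ?a = rng G ?b" by (simp add: src_arrow_map rng_arrow_map hk)
  have rhk: "rng H (gmult H h k) = rng H h" by (rule cod.rng_gmult[OF comp])
  hence ac: "rng G ?a = rng G ?c" by (simp add: rng_arrow_map)
  obtain f U g where f: "f \<in> Cc K" "f ?a = 1" "\<And>b. rng G b = rng G ?a \<Longrightarrow> b \<noteq> ?a \<Longrightarrow> f b = 0"
    and U: "open U" "inj_on (rng G) U" "open (rng G ` U)" "continuous_on (rng G ` U) g"
      "\<And>x. x \<in> U \<Longrightarrow> g (rng G x) = x" "supp f \<subseteq> U"
    using dom.bisection_bump[of ?a] by metis
  obtain e where e: "e \<in> Cc K" "e ?b = 1" "\<And>b. rng G b = rng G ?b \<Longrightarrow> b \<noteq> ?b \<Longrightarrow> e b = 0"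
    using dom.bisection_bump[of ?b] by metis
  have fe: "convolution G \<mu>G f e \<in> Cc K"
    by (rule dom.convolution_bisection_Cc[OF f(1) e(1) U])
  have left: "convolution G \<mu>G f e ?c = of_real (dom.mass ?a) * (f ?a * e (gmult G (ginv G ?a) ?c))"
    by (rule dom.convolution_single) (use ac f(3) in auto)
  have "convolution H \<mu>H (T f) (T e) (gmult H h k)
      = of_real (cod.mass h) * (T f h * T e (gmult H (ginv H h) (gmult H h k)))"
  proof (rule cod.convolution_single)
    fix s assume s: "rng H s = rng H (gmult H h k)" "s \<noteq> h"
    have "arrow_map s \<noteq> ?a" using s(2) bij_arrow_map by (metis bij_is_inj inj_eq)
    moreover have "rng G (arrow_map s) = rng G ?a" by (simp add: rng_arrow_map s(1) rhk)
    ultimately have "T f s = 0" by (simp add: T_eq[OF f(1)] f(3))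
    thus "T f s * T e (gmult H (ginv H s) (gmult H h k)) = 0" by simp
  qed (simp add: rhk)
  also have "\<dots> = of_real (cod.mass h) * (coeff h * coeff k)"
    by (simp add: cod.ginv_gmult_cancel[OF hk] T_eq[OF f(1)] T_eq[OF e(1)] f(2) e(2))
  finally have eq: "coeff (gmult H h k) * (of_real (dom.mass ?a) * e (gmult G (ginv G ?a) ?c))
      = of_real (cod.mass h) * (coeff h * coeff k)"
    using T_eq[OF fe, of "gmult H h k"] T_mult[OF f(1) e(1)] left f(2) by simp
  hence "e (gmult G (ginv G ?a) ?c) \<noteq> 0"
    using coeff_nonzero[of h] coeff_nonzero[of k] cod.mass_nonzero[of h] by auto
  hence "gmult G (ginv G ?a) ?c = ?b"
    using e(3) dom.rng_ginv_gmult[OF ac] ab by metis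
  thus "?c = gmult G ?a ?b" using dom.gmult_eq_iff[OF ab ac] by simp
  show "coeff (gmult H h k) * of_real (dom.mass ?a) = of_real (cod.mass h) * coeff h * coeff k"
    using eq \<open>gmult G (ginv G ?a) ?c = ?b\<close> e(2) by (simp add: mult.assoc)
qed

lemma arrow_map_morphism: "groupoid_morphism H G arrow_map"
  unfolding groupoid_morphism_def
  by (auto simp: arrow_map_gmult_coeff(1) composable_def src_arrow_map rng_arrow_map)

text \<open>Composability is reflected because \<open>unit_map\<close> is injective on
  units.\<close>

lemma inv_arrow_map_morphism: "groupoid_morphism G H (inv arrow_map)"
  unfolding groupoid_morphism_def
proof (intro allI impI)
  fix a b assume ab: "composable G a b"
  obtain h k where hk: "a = arrow_map h" "b = arrow_map k"
    using bij_arrow_map by (metis bij_pointE)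
  have i: "inv arrow_map (arrow_map x) = x" for x
    using bij_arrow_map by (simp add: bij_is_inj)
  have "unit_map (src H h) = unit_map (rng H k)"
    using ab by (simp add: hk composable_def src_arrow_map rng_arrow_map)
  hence c: "composable H h k"
    unfolding composable_def by (rule inj_onD[OF inj_unit_map]) auto
  show "composable H (inv arrow_map a) (inv arrow_map b) \<and>
      inv arrow_map (gmult G a b) = gmult H (inv arrow_map a) (inv arrow_map b)"
    using c by (simp add: hk i arrow_map_gmult_coeff(1)[symmetric])
qed

lemma arrow_map_isomorphism: "topological_groupoid_isomorphism H G arrow_map"
proof -
  have "homeomorphic_maps euclidean euclidean arrow_map (inv arrow_map)"
    unfolding homeomorphic_maps_def
    using continuous_arrow_map continuous_inv_arrow_map bij_arrow_map
    by (auto simp: bij_is_inj bij_is_surj surj_f_inv_f)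
  thus ?thesis
    unfolding topological_groupoid_isomorphism_def
    using arrow_map_morphism inv_arrow_map_morphism bij_arrow_map homeomorphic_maps_imp_map by blast
qed

text \<open>Masses depend only on the source, so those at a product are those at its second factor.
  The remaining masses, at \<open>h\<close> and \<open>arrow_map h\<close>, are the ones in the
  coefficient identity.\<close>

lemma phase_morphism: "continuous_circle_morphism H phase"
  unfolding continuous_circle_morphism_def
proof (intro conjI allI impI continuous_phase norm_phase)
  fix h k assume comp: "composable H h k"
  have m: "dom.mass (arrow_map (gmult H h k)) = dom.mass (arrow_map k)"
    using dom.mass_src[of "arrow_map (gmult H h k)"] dom.mass_src[of "arrow_map k"]
    by (simp add: src_arrow_map cod.src_gmult[OF comp])
  have m': "cod.mass (gmult H h k) = cod.mass k"
    using cod.mass_src[of "gmult H h k"] cod.mass_src[of k] by (simp add: cod.src_gmult[OF comp])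
  have "coeff (gmult H h k) = of_real (cod.mass h) * coeff h * coeff k / of_real (dom.mass (arrow_map h))"
    using arrow_map_gmult_coeff(2)[OF comp] dom.mass_nonzero[of "arrow_map h"] by (simp add: field_simps)
  thus "phase (gmult H h k) = phase h * phase k"
    by (simp add: phase_def m m')
qed

end

theorem theorem3p27:
  fixes K :: "complex set"
    and G :: "'g::t2_space groupoid_ops" and \<mu>G :: "'g \<Rightarrow> 'g measure"
    and H :: "'h::t2_space groupoid_ops" and \<mu>H :: "'h \<Rightarrow> 'h measure"
    and T :: "('g \<Rightarrow> complex) \<Rightarrow> ('h \<Rightarrow> complex)"
  assumes "K = \<real> \<or> K = UNIV"
    and "lch_etale_groupoid G" and "lch_etale_groupoid H"
    and "fully_supported_haar_system K G \<mu>G"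
    and "fully_supported_haar_system K H \<mu>H"
    and "convolution_algebra_isomorphism K G \<mu>G H \<mu>H T"
    and "T ` Cc_diag K G = Cc_diag K H"
    and "\<forall>f \<in> Cc K. Ir_norm H \<mu>H (T f) = Ir_norm G \<mu>G f"
  shows "\<exists>!\<phi>. topological_groupoid_isomorphism H G \<phi> \<and>
           (\<exists>p D. continuous_circle_morphism H p \<and>
                  continuous_RN_derivative G \<mu>G \<mu>H \<phi> D \<and>
                  (\<forall>f \<in> Cc K. \<forall>h. T f h = p h * of_real (D (\<phi> h)) * f (\<phi> h)))"
proof -
  interpret dom: etale_haar K G \<mu>G
    by (intro etale_haar.intro etale_haar_axioms.intro assms)
  interpret cod: etale_haar K H \<mu>H
    by (intro etale_haar.intro etale_haar_axioms.intro assms)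
  note iso = assms(6)[unfolded convolution_algebra_isomorphism_def]
  have diag: "d \<in> Cc_diag K G \<Longrightarrow> d \<in> Cc K" for d :: "'g \<Rightarrow> complex"
    by (rule dom.Cc_diagD(1))
  interpret diag_algebra_isometry K G \<mu>G H \<mu>H T
    by unfold_locales (use iso assms(7,8) diag in auto)
  show ?thesis
  proof (rule ex1I[of _ arrow_map])
    show "topological_groupoid_isomorphism H G arrow_map \<and>
        (\<exists>p D. continuous_circle_morphism H p \<and> continuous_RN_derivative G \<mu>G \<mu>H arrow_map D \<and>
          (\<forall>f \<in> Cc K. \<forall>h. T f h = p h * of_real (D (arrow_map h)) * f (arrow_map h)))"
      using arrow_map_isomorphism phase_morphism density_ratio_RN T_eq_phase_density by blast
  next
    fix \<psi>
    assume "topological_groupoid_isomorphism H G \<psi> \<and>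
        (\<exists>p D. continuous_circle_morphism H p \<and> continuous_RN_derivative G \<mu>G \<mu>H \<psi> D \<and>
          (\<forall>f \<in> Cc K. \<forall>h. T f h = p h * of_real (D (\<psi> h)) * f (\<psi> h)))"
    then obtain p D where "\<And>f h. f \<in> Cc K \<Longrightarrow> T f h = p h * of_real (D (\<psi> h)) * f (\<psi> h)"
      by blast
    \<comment> \<open>With \<open>p h * of_real (D (\<psi> h))\<close> as the factor,
      \<open>T f h\<close> is a multiple of \<open>f (\<psi> h)\<close> for every \<open>f\<close>,
      which determines the point.\<close>
    hence "arrow_map h = \<psi> h" for h by (rule arrow_map_unique)
    thus "\<psi> = arrow_map" by auto
  qed
qed

end
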